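(* Let $\Omega\colon G\to H$ and $\Lambda\colon H\to K$ be proper second countable Hausdorff étale correspondences and consider the $G$-equivariant $*$-isomorphism \[\varphi_{C_0(K^0)}\colon\mathrm{Ind}_\Omega\mathrm{Ind}_\Lambda C_0(K^0)\to\mathrm{Ind}_{\Lambda\circ\Omega}C_0(K^0),\qquad\varphi_{C_0(K^0)}(\xi)([\omega,\lambda]_H)=\xi(\omega)(\lambda).\] Then \[\varphi_{C_0(K^0)}\circ\mathrm{Ind}_\Omega(\overline\rho_\Lambda^* )\circ\overline\rho_\Omega^*=\overline\rho_{\Lambda\circ\Omega}^*\colon C_0(G^0)\to\mathrm{Ind}_{\Lambda\circ\Omega}C_0(K^0).\]
   Context: An étale groupoid $G$ is a topological groupoid (range $r$, source $s$, product $gh$ defined when $s(g)=r(h)$) whose unit space $G^0$ is open in $G$, locally compact and Hausdorff, and whose range map is a local homeomorphism; $G^x=r^{-1}(x)$. A left action of $G$ on a space $X$ consists of a continuous anchor map $\tau\colon X\to G^0$ and a continuous map $(g,x)\mapsto g\cdot x$, defined when $s(g)=\tau(x)$, with $\tau(g\cdot x)=r(g)$, $(gh)\cdot x=g\cdot(h\cdot x)$, units acting trivially; right actions are analogous. An action is free if only units fix points, proper if $(g,x)\mapsto(g\cdot x,x)\in X\times X$ is a proper map, étale if $\tau$ is a local homeomorphism. An étale correspondence $\Omega\colon G\to H$ of étale groupoids is a space with commuting left $G$-action (anchor $\rho_\Omega\colon\Omega\to G^0$) and right $H$-action (anchor $\sigma_\Omega\colon\Omega\to H^0$), such that the right action is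 free, proper and étale. It is Hausdorff (second countable) if $\Omega,G,H$ all are, and proper if the induced map $\overline\rho_\Omega\colon\Omega/H\to G^0$ is proper. The composition $\Lambda\circ\Omega\colon G\to K$ is $\Omega\times_H\Lambda=\{(\omega,\lambda):\sigma_\Omega(\omega)=\rho_\Lambda(\lambda)\}/H$ for the action $(\omega,\lambda)\cdot h=(\omega\cdot h,h^{-1}\cdot\lambda)$, with classes $[\omega,\lambda]_H$, $g\cdot[\omega,\lambda]_H=[g\cdot\omega,\lambda]_H$ and $[\omega,\lambda]_H\cdot k=[\omega,\lambda\cdot k]_H$. A $C_0(X)$-algebra $A$ has fibres $A_x=A/\overline{C_0(X\setminus\{x\})A}$ and an associated bundle $\mathcal A=\bigsqcup_xA_x$ with the unique Banach bundle topology (upper semicontinuous norm) making all sections $x\mapsto a_x$, $a\in A$, continuous. A $G$-$C^*$-algebra ($G$ Hausdorff étale) is a $C_0(G^0)$-algebra with a continuous action of $G$ on $\mathcal A$ by $*$-isomorphisms $A_{s(g)}\to A_{r(g)}$; $C_0(G^0)$ has fibres $\mathbb C$ with trivial action on fibres. For an $H$-$C^*$-algebra $A$, $\mathrm{Ind}_\Omega A$ is the $C^*$-algebra (sup norm, pointwise operations) of bounded continuous sections $\xi$ of $\sigma_\Omega^*\mathcal A\to\Omega$ with $\xi(\omega\cdot h)=h^{-1}\cdot\xi(\omega)$ for $h\in H^{\sigma_\Omega(\omega)}$ and $[\omega]_H\mapsto\|\xi(\omega)\|$ vanishing at infinity on $\Omega/H$. It is a $G$-$C^*$-algebra via $(\delta\xi)(\omega)=\delta(\rho_\Omega(\omega))\xi(\omega)$,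 $\delta\in C_0(G^0)$, fibres over $x\in G^0$ given by restriction to $\rho_\Omega^{-1}(x)$, and $(g\cdot\xi)(\omega)=\xi(g^{-1}\cdot\omega)$. An $H$-equivariant $*$-homomorphism $\psi\colon A\to B$ induces $\mathrm{Ind}_\Omega(\psi)\colon\mathrm{Ind}_\Omega A\to\mathrm{Ind}_\Omega B$, $(\mathrm{Ind}_\Omega(\psi)\xi)(\omega)=\psi_{\sigma_\Omega(\omega)}(\xi(\omega))$. $\mathrm{Ind}_\Omega C_0(H^0)$ is identified with $C_0(\Omega/H)$ via $\xi\leftrightarrow([\omega]_H\mapsto\xi(\omega))$. For $\Omega$ proper, $\overline\rho_\Omega^*\colon C_0(G^0)\to\mathrm{Ind}_\Omega C_0(H^0)$ is the $G$-equivariant $*$-homomorphism $f\mapsto f\circ\overline\rho_\Omega$, i.e. $\overline\rho_\Omega^*(f)(\omega)=f(\rho_\Omega(\omega))$; $\overline\rho_\Lambda^*\colon C_0(H^0)\to\mathrm{Ind}_\Lambda C_0(K^0)$ and $\overline\rho_{\Lambda\circ\Omega}^*$ are defined likewise. *)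

theory Defs
  imports "HOL-Analysis.Analysis"
begin

section \<open>Topological preliminaries\<close>

definition local_homeomorphism :: "'a topology \<Rightarrow> 'b topology \<Rightarrow> ('a \<Rightarrow> 'b) \<Rightarrow> bool" where
  "local_homeomorphism X Y f \<longleftrightarrow>
     (\<forall>x \<in> topspace X. \<exists>U. openin X U \<and> x \<in> U \<and> openin Y (f ` U) \<and>
        homeomorphic_map (subtopology X U) (subtopology Y (f ` U)) f)"

definition quotient_topology :: "'a topology \<Rightarrow> ('a \<Rightarrow> 'b) \<Rightarrow> 'b topology" where
  "quotient_topology X q =
     topology (\<lambda>V. V \<subseteq> q ` topspace X \<and> openin X {x \<in> topspace X. q x \<in> V})"

lemma istopology_quotient:
  "istopology (\<lambda>V. V \<subseteq> q ` topspace X \<and> openin X {x \<in> topspace X. q x \<in> V})"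
proof -
  have "{x \<in> topspace X. q x \<in> S \<inter> T} = {x \<in> topspace X. q x \<in> S} \<inter> {x \<in> topspace X. q x \<in> T}"
    for S T by blast
  moreover have "{x \<in> topspace X. q x \<in> \<Union>\<K>} = (\<Union>V\<in>\<K>. {x \<in> topspace X. q x \<in> V})" for \<K>
    by blast
  ultimately show ?thesis
    unfolding istopology_def by (auto intro!: openin_Union)
qed

lemma openin_quotient_topology:
  "openin (quotient_topology X q) V \<longleftrightarrow>
     V \<subseteq> q ` topspace X \<and> openin X {x \<in> topspace X. q x \<in> V}"
  unfolding quotient_topology_def using istopology_quotient[of q X]
  by (simp add: topology_inverse')

text \<open>The value at \<open>z\<close> of the function induced by \<open>f\<close> on a set of equivalence classes; it is
  meaningful when \<open>f\<close> is constant on the class \<open>z\<close>.\<close>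

definition lift_class :: "('a \<Rightarrow> 'b) \<Rightarrow> 'a set \<Rightarrow> 'b" where
  "lift_class f z = the_elem (f ` z)"

definition vanishes_at_infinity :: "'a topology \<Rightarrow> ('a \<Rightarrow> real) \<Rightarrow> bool" where
  "vanishes_at_infinity X f \<longleftrightarrow>
     (\<forall>\<epsilon>>0. \<exists>C. compactin X C \<and> (\<forall>x \<in> topspace X - C. \<bar>f x\<bar> < \<epsilon>))"


section \<open>Etale groupoids and actions\<close>

text \<open>The unit space is a subset of the space of arrows. \<open>gmul G g h\<close> is only meaningful for
  \<open>gsrc G g = grng G h\<close>.\<close>

record 'g groupoid =
  gtop :: "'g topology"
  gunits :: "'g set"
  grng :: "'g \<Rightarrow> 'g"
  gsrc :: "'g \<Rightarrow> 'g"
  gmul :: "'g \<Rightarrow> 'g \<Rightarrow> 'g"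
  ginv :: "'g \<Rightarrow> 'g"

abbreviation arrows :: "('g, 'm) groupoid_scheme \<Rightarrow> 'g set" where
  "arrows G \<equiv> topspace (gtop G)"

abbreviation unit_space :: "('g, 'm) groupoid_scheme \<Rightarrow> 'g topology" where
  "unit_space G \<equiv> subtopology (gtop G) (gunits G)"

locale topological_groupoid =
  fixes G :: "'g groupoid"
  assumes units_subset: "gunits G \<subseteq> arrows G"
    and rng_unit: "g \<in> arrows G \<Longrightarrow> grng G g \<in> gunits G"
    and src_unit: "g \<in> arrows G \<Longrightarrow> gsrc G g \<in> gunits G"
    and rng_of_unit: "x \<in> gunits G \<Longrightarrow> grng G x = x"
    and src_of_unit: "x \<in> gunits G \<Longrightarrow> gsrc G x = x"
    and mul_closed: "\<lbrakk>g \<in> arrows G; h \<in> arrows G; gsrc G g = grng G h\<rbrakk> \<Longrightarrow> gmul G g h \<in> arrows G"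
    and rng_mul: "\<lbrakk>g \<in> arrows G; h \<in> arrows G; gsrc G g = grng G h\<rbrakk> \<Longrightarrow> grng G (gmul G g h) = grng G g"
    and src_mul: "\<lbrakk>g \<in> arrows G; h \<in> arrows G; gsrc G g = grng G h\<rbrakk> \<Longrightarrow> gsrc G (gmul G g h) = gsrc G h"
    and mul_assoc: "\<lbrakk>g \<in> arrows G; h \<in> arrows G; k \<in> arrows G;
        gsrc G g = grng G h; gsrc G h = grng G k\<rbrakk>
        \<Longrightarrow> gmul G (gmul G g h) k = gmul G g (gmul G h k)"
    and unit_mul: "g \<in> arrows G \<Longrightarrow> gmul G (grng G g) g = g"
    and mul_unit: "g \<in> arrows G \<Longrightarrow> gmul G g (gsrc G g) = g"
    and inv_closed: "g \<in> arrows G \<Longrightarrow> ginv G g \<in> arrows G"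
    and rng_inv: "g \<in> arrows G \<Longrightarrow> grng G (ginv G g) = gsrc G g"
    and src_inv: "g \<in> arrows G \<Longrightarrow> gsrc G (ginv G g) = grng G g"
    and inv_mul: "g \<in> arrows G \<Longrightarrow> gmul G (ginv G g) g = gsrc G g"
    and mul_inv: "g \<in> arrows G \<Longrightarrow> gmul G g (ginv G g) = grng G g"
    and continuous_rng: "continuous_map (gtop G) (gtop G) (grng G)"
    and continuous_src: "continuous_map (gtop G) (gtop G) (gsrc G)"
    and continuous_inv: "continuous_map (gtop G) (gtop G) (ginv G)"
    and continuous_mul:
      "continuous_map
         (subtopology (prod_topology (gtop G) (gtop G)) {(g, h). gsrc G g = grng G h})
         (gtop G) (\<lambda>(g, h). gmul G g h)"

locale etale_groupoid = topological_groupoid G for G :: "'g groupoid" +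
  assumes open_units: "openin (gtop G) (gunits G)"
    and locally_compact_units: "locally_compact_space (unit_space G)"
    and Hausdorff_units: "Hausdorff_space (unit_space G)"
    and etale_rng: "local_homeomorphism (gtop G) (unit_space G) (grng G)"

locale left_action =
  fixes G :: "'g groupoid" and X :: "'x topology"
    and \<tau> :: "'x \<Rightarrow> 'g" and act :: "'g \<Rightarrow> 'x \<Rightarrow> 'x"
  assumes continuous_anchor: "continuous_map X (unit_space G) \<tau>"
    and continuous_act:
      "continuous_map (subtopology (prod_topology (gtop G) X) {(g, x). gsrc G g = \<tau> x})
         X (\<lambda>(g, x). act g x)"
    and anchor_act:
      "\<lbrakk>g \<in> arrows G; x \<in> topspace X; gsrc G g = \<tau> x\<rbrakk> \<Longrightarrow> \<tau> (act g x) = grng G g"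
    and act_mul:
      "\<lbrakk>g \<in> arrows G; h \<in> arrows G; x \<in> topspace X; gsrc G g = grng G h; gsrc G h = \<tau> x\<rbrakk>
        \<Longrightarrow> act (gmul G g h) x = act g (act h x)"
    and act_unit: "x \<in> topspace X \<Longrightarrow> act (\<tau> x) x = x"

locale right_action =
  fixes H :: "'h groupoid" and X :: "'x topology"
    and \<sigma> :: "'x \<Rightarrow> 'h" and act :: "'x \<Rightarrow> 'h \<Rightarrow> 'x"
  assumes continuous_anchor: "continuous_map X (unit_space H) \<sigma>"
    and continuous_act:
      "continuous_map (subtopology (prod_topology X (gtop H)) {(x, h). \<sigma> x = grng H h})
         X (\<lambda>(x, h). act x h)"
    and anchor_act:
      "\<lbrakk>h \<in> arrows H; x \<in> topspace X; \<sigma> x = grng H h\<rbrakk> \<Longrightarrow> \<sigma> (act x h) = gsrc H h"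
    and act_mul:
      "\<lbrakk>g \<in> arrows H; h \<in> arrows H; x \<in> topspace X; \<sigma> x = grng H g; gsrc H g = grng H h\<rbrakk>
        \<Longrightarrow> act x (gmul H g h) = act (act x g) h"
    and act_unit: "x \<in> topspace X \<Longrightarrow> act x (\<sigma> x) = x"

definition right_orbit ::
    "'h groupoid \<Rightarrow> ('x \<Rightarrow> 'h) \<Rightarrow> ('x \<Rightarrow> 'h \<Rightarrow> 'x) \<Rightarrow> 'x \<Rightarrow> 'x set" where
  "right_orbit H \<sigma> act x = {act x h | h. h \<in> arrows H \<and> grng H h = \<sigma> x}"

definition orbit_space ::
    "'h groupoid \<Rightarrow> 'x topology \<Rightarrow> ('x \<Rightarrow> 'h) \<Rightarrow> ('x \<Rightarrow> 'h \<Rightarrow> 'x) \<Rightarrow> 'x set topology" where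
  "orbit_space H X \<sigma> act = quotient_topology X (right_orbit H \<sigma> act)"


section \<open>Etale correspondences\<close>

record ('o, 'g, 'h) correspondence =
  ctop :: "'o topology"
  lanchor :: "'o \<Rightarrow> 'g"
  ranchor :: "'o \<Rightarrow> 'h"
  lact :: "'g \<Rightarrow> 'o \<Rightarrow> 'o"
  ract :: "'o \<Rightarrow> 'h \<Rightarrow> 'o"

locale etale_correspondence =
  G: etale_groupoid G + H: etale_groupoid H +
  left: left_action G "ctop \<Omega>" "lanchor \<Omega>" "lact \<Omega>" +
  right: right_action H "ctop \<Omega>" "ranchor \<Omega>" "ract \<Omega>"
  for G :: "'g groupoid" and H :: "'h groupoid" and \<Omega> :: "('o, 'g, 'h) correspondence" +
  assumes lanchor_ract:
      "\<lbrakk>\<omega> \<in> topspace (ctop \<Omega>); h \<in> arrows H; ranchor \<Omega> \<omega> = grng H h\<rbrakk>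
        \<Longrightarrow> lanchor \<Omega> (ract \<Omega> \<omega> h) = lanchor \<Omega> \<omega>"
    and ranchor_lact:
      "\<lbrakk>\<omega> \<in> topspace (ctop \<Omega>); g \<in> arrows G; gsrc G g = lanchor \<Omega> \<omega>\<rbrakk>
        \<Longrightarrow> ranchor \<Omega> (lact \<Omega> g \<omega>) = ranchor \<Omega> \<omega>"
    and actions_commute:
      "\<lbrakk>\<omega> \<in> topspace (ctop \<Omega>); g \<in> arrows G; h \<in> arrows H;
        gsrc G g = lanchor \<Omega> \<omega>; ranchor \<Omega> \<omega> = grng H h\<rbrakk>
        \<Longrightarrow> ract \<Omega> (lact \<Omega> g \<omega>) h = lact \<Omega> g (ract \<Omega> \<omega> h)"
    and right_free:
      "\<lbrakk>\<omega> \<in> topspace (ctop \<Omega>); h \<in> arrows H; ranchor \<Omega> \<omega> = grng H h; ract \<Omega> \<omega> h = \<omega>\<rbrakk>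
        \<Longrightarrow> h \<in> gunits H"
    and right_proper:
      "proper_map
         (subtopology (prod_topology (ctop \<Omega>) (gtop H)) {(\<omega>, h). ranchor \<Omega> \<omega> = grng H h})
         (prod_topology (ctop \<Omega>) (ctop \<Omega>)) (\<lambda>(\<omega>, h). (ract \<Omega> \<omega> h, \<omega>))"
    and right_etale: "local_homeomorphism (ctop \<Omega>) (unit_space H) (ranchor \<Omega>)"

definition Hausdorff_correspondence ::
    "'g groupoid \<Rightarrow> 'h groupoid \<Rightarrow> ('o, 'g, 'h) correspondence \<Rightarrow> bool" where
  "Hausdorff_correspondence G H \<Omega> \<longleftrightarrow>
     Hausdorff_space (ctop \<Omega>) \<and> Hausdorff_space (gtop G) \<and> Hausdorff_space (gtop H)"

definition second_countable_correspondence ::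
    "'g groupoid \<Rightarrow> 'h groupoid \<Rightarrow> ('o, 'g, 'h) correspondence \<Rightarrow> bool" where
  "second_countable_correspondence G H \<Omega> \<longleftrightarrow>
     second_countable (ctop \<Omega>) \<and> second_countable (gtop G) \<and> second_countable (gtop H)"

definition corr_class :: "'h groupoid \<Rightarrow> ('o, 'g, 'h) correspondence \<Rightarrow> 'o \<Rightarrow> 'o set" where
  "corr_class H \<Omega> = right_orbit H (ranchor \<Omega>) (ract \<Omega>)"

definition corr_quotient ::
    "'h groupoid \<Rightarrow> ('o, 'g, 'h) correspondence \<Rightarrow> 'o set topology" where
  "corr_quotient H \<Omega> = orbit_space H (ctop \<Omega>) (ranchor \<Omega>) (ract \<Omega>)"

definition proper_correspondence ::
    "'g groupoid \<Rightarrow> 'h groupoid \<Rightarrow> ('o, 'g, 'h) correspondence \<Rightarrow> bool" where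
  "proper_correspondence G H \<Omega> \<longleftrightarrow>
     proper_map (corr_quotient H \<Omega>) (unit_space G) (lift_class (lanchor \<Omega>))"

definition comp_class ::
    "'h groupoid \<Rightarrow> ('l, 'h, 'k) correspondence \<Rightarrow> ('o, 'g, 'h) correspondence
      \<Rightarrow> 'o \<times> 'l \<Rightarrow> ('o \<times> 'l) set" where
  "comp_class H \<Lambda> \<Omega> =
     right_orbit H (\<lambda>(\<omega>, l). ranchor \<Omega> \<omega>) (\<lambda>(\<omega>, l) h. (ract \<Omega> \<omega> h, lact \<Lambda> (ginv H h) l))"

text \<open>\<open>corr_comp H \<Lambda> \<Omega>\<close> is the composition of \<open>\<Omega>\<close> from \<open>G\<close> to \<open>H\<close> followed by
  \<open>\<Lambda>\<close> from \<open>H\<close> to \<open>K\<close>; its points are \<open>H\<close>-orbits in the fibre product.\<close>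

definition corr_comp ::
    "'h groupoid \<Rightarrow> ('l, 'h, 'k) correspondence \<Rightarrow> ('o, 'g, 'h) correspondence
      \<Rightarrow> (('o \<times> 'l) set, 'g, 'k) correspondence" where
  "corr_comp H \<Lambda> \<Omega> =
     \<lparr> ctop = orbit_space H
         (subtopology (prod_topology (ctop \<Omega>) (ctop \<Lambda>)) {(\<omega>, l). ranchor \<Omega> \<omega> = lanchor \<Lambda> l})
         (\<lambda>(\<omega>, l). ranchor \<Omega> \<omega>) (\<lambda>(\<omega>, l) h. (ract \<Omega> \<omega> h, lact \<Lambda> (ginv H h) l)),
       lanchor = lift_class (\<lambda>(\<omega>, l). lanchor \<Omega> \<omega>),
       ranchor = lift_class (\<lambda>(\<omega>, l). ranchor \<Lambda> l),
       lact = (\<lambda>g. lift_class (\<lambda>(\<omega>, l). comp_class H \<Lambda> \<Omega> (lact \<Omega> g \<omega>, l))),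
       ract = (\<lambda>z k. lift_class (\<lambda>(\<omega>, l). comp_class H \<Lambda> \<Omega> (\<omega>, ract \<Lambda> l k)) z) \<rparr>"


section \<open>Groupoid C*-algebras\<close>

record 'a star_algebra =
  alg_set :: "'a set"
  alg_add :: "'a \<Rightarrow> 'a \<Rightarrow> 'a"
  alg_scale :: "complex \<Rightarrow> 'a \<Rightarrow> 'a"
  alg_mult :: "'a \<Rightarrow> 'a \<Rightarrow> 'a"
  alg_star :: "'a \<Rightarrow> 'a"
  alg_norm :: "'a \<Rightarrow> real"

definition complex_algebra :: "complex star_algebra" where
  "complex_algebra =
     \<lparr> alg_set = UNIV, alg_add = (+), alg_scale = (*), alg_mult = (*),
       alg_star = cnj, alg_norm = cmod \<rparr>"

text \<open>The set \<open>C\<close> of functions \<open>\<xi>\<close> on \<open>S\<close> with \<open>\<xi> s\<close> in \<open>F s\<close>, with pointwise operations and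
  supremum norm. The \<open>0\<close> in the supremum only matters for empty \<open>S\<close>.\<close>

definition section_algebra ::
    "'s set \<Rightarrow> ('s \<Rightarrow> 'a star_algebra) \<Rightarrow> ('s \<Rightarrow> 'a) set \<Rightarrow> ('s \<Rightarrow> 'a) star_algebra" where
  "section_algebra S F C =
     \<lparr> alg_set = C,
       alg_add = (\<lambda>\<xi> \<eta>. \<lambda>s\<in>S. alg_add (F s) (\<xi> s) (\<eta> s)),
       alg_scale = (\<lambda>c \<xi>. \<lambda>s\<in>S. alg_scale (F s) c (\<xi> s)),
       alg_mult = (\<lambda>\<xi> \<eta>. \<lambda>s\<in>S. alg_mult (F s) (\<xi> s) (\<eta> s)),
       alg_star = (\<lambda>\<xi>. \<lambda>s\<in>S. alg_star (F s) (\<xi> s)),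
       alg_norm = (\<lambda>\<xi>. Sup (insert 0 ((\<lambda>s. alg_norm (F s) (\<xi> s)) ` S))) \<rparr>"

text \<open>The data of a \<open>G\<close>-C*-algebra \<open>A\<close>: \<open>smul\<close> is the structure map of the
  \<open>C\<^sub>0(G\<^sup>0)\<close>-algebra, \<open>fibre A x\<close> is the quotient of \<open>A\<close> by the closure of
  \<open>C\<^sub>0(G\<^sup>0 - {x})A\<close>, \<open>proj A x\<close> is the quotient map \<open>a \<mapsto> a\<^sub>x\<close>, and \<open>fibre_act g\<close> is the
  isomorphism from the fibre over the source of \<open>g\<close> to the fibre over its range.
  The fibres are part of the data, so that the fibres of \<open>C\<^sub>0(X)\<close> can be the complex numbers
  and those of an induced algebra can be restrictions of sections, rather than sets of cosets.\<close>

record ('g, 'a, 'f) gpd_algebra =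
  alg_of :: "'a star_algebra"
  smul :: "('g \<Rightarrow> complex) \<Rightarrow> 'a \<Rightarrow> 'a"
  fibre :: "'g \<Rightarrow> 'f star_algebra"
  proj :: "'g \<Rightarrow> 'a \<Rightarrow> 'f"
  fibre_act :: "'g \<Rightarrow> 'f \<Rightarrow> 'f"

text \<open>The Banach bundle topology on the disjoint union of the fibres: its basic open sets are the
  tubes around the sections \<open>x \<mapsto> a\<^sub>x\<close>.\<close>

definition bundle_topology ::
    "'g groupoid \<Rightarrow> ('g, 'a, 'f) gpd_algebra \<Rightarrow> ('g \<times> 'f) topology" where
  "bundle_topology G A = topology_generated_by
     {{(x, v). x \<in> U \<and> v \<in> alg_set (fibre A x) \<and>
          alg_norm (fibre A x) (alg_add (fibre A x) v (alg_scale (fibre A x) (-1) (proj A x a))) < \<epsilon>}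
       | a U \<epsilon>. a \<in> alg_set (alg_of A) \<and> openin (unit_space G) U \<and> \<epsilon> > 0}"

definition C0_functions :: "'x topology \<Rightarrow> ('x \<Rightarrow> complex) set" where
  "C0_functions X =
     {f \<in> extensional (topspace X). continuous_map X euclidean f \<and>
        vanishes_at_infinity X (\<lambda>x. cmod (f x))}"

definition C0_algebra :: "'g groupoid \<Rightarrow> ('g, 'g \<Rightarrow> complex, complex) gpd_algebra" where
  "C0_algebra G =
     \<lparr> alg_of = section_algebra (gunits G) (\<lambda>x. complex_algebra) (C0_functions (unit_space G)),
       smul = (\<lambda>\<delta> f. \<lambda>x\<in>gunits G. \<delta> x * f x),
       fibre = (\<lambda>x. complex_algebra),
       proj = (\<lambda>x f. f x),
       fibre_act = (\<lambda>g v. v) \<rparr>"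


section \<open>Induced algebras\<close>

text \<open>Continuity of \<open>\<xi>\<close> as a section of the pulled back bundle is continuity of
  \<open>\<omega> \<mapsto> (\<sigma> \<omega>, \<xi> \<omega>)\<close> into the bundle over the unit space of \<open>H\<close>.\<close>

definition Ind_sections ::
    "'h groupoid \<Rightarrow> ('o, 'g, 'h) correspondence \<Rightarrow> ('h, 'a, 'f) gpd_algebra \<Rightarrow> ('o \<Rightarrow> 'f) set" where
  "Ind_sections H \<Omega> A =
     {\<xi> \<in> extensional (topspace (ctop \<Omega>)).
        continuous_map (ctop \<Omega>) (bundle_topology H A) (\<lambda>\<omega>. (ranchor \<Omega> \<omega>, \<xi> \<omega>)) \<and>
        (\<exists>B. \<forall>\<omega> \<in> topspace (ctop \<Omega>). alg_norm (fibre A (ranchor \<Omega> \<omega>)) (\<xi> \<omega>) \<le> B) \<and>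
        (\<forall>\<omega> \<in> topspace (ctop \<Omega>). \<forall>h \<in> arrows H. grng H h = ranchor \<Omega> \<omega> \<longrightarrow>
           \<xi> (ract \<Omega> \<omega> h) = fibre_act A (ginv H h) (\<xi> \<omega>)) \<and>
        vanishes_at_infinity (corr_quotient H \<Omega>)
          (lift_class (\<lambda>\<omega>. alg_norm (fibre A (ranchor \<Omega> \<omega>)) (\<xi> \<omega>)))}"

definition anchor_fibre :: "('o, 'g, 'h) correspondence \<Rightarrow> 'g \<Rightarrow> 'o set" where
  "anchor_fibre \<Omega> x = {\<omega> \<in> topspace (ctop \<Omega>). lanchor \<Omega> \<omega> = x}"

definition Ind ::
    "'g groupoid \<Rightarrow> 'h groupoid \<Rightarrow> ('o, 'g, 'h) correspondence \<Rightarrow> ('h, 'a, 'f) gpd_algebra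
      \<Rightarrow> ('g, 'o \<Rightarrow> 'f, 'o \<Rightarrow> 'f) gpd_algebra" where
  "Ind G H \<Omega> A =
     \<lparr> alg_of = section_algebra (topspace (ctop \<Omega>)) (\<lambda>\<omega>. fibre A (ranchor \<Omega> \<omega>))
         (Ind_sections H \<Omega> A),
       smul = (\<lambda>\<delta> \<xi>. \<lambda>\<omega>\<in>topspace (ctop \<Omega>).
         alg_scale (fibre A (ranchor \<Omega> \<omega>)) (\<delta> (lanchor \<Omega> \<omega>)) (\<xi> \<omega>)),
       fibre = (\<lambda>x. section_algebra (anchor_fibre \<Omega> x) (\<lambda>\<omega>. fibre A (ranchor \<Omega> \<omega>))
         ((\<lambda>\<xi>. restrict \<xi> (anchor_fibre \<Omega> x)) ` Ind_sections H \<Omega> A)),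
       proj = (\<lambda>x \<xi>. restrict \<xi> (anchor_fibre \<Omega> x)),
       fibre_act = (\<lambda>g v. \<lambda>\<omega>\<in>anchor_fibre \<Omega> (grng G g). v (lact \<Omega> (ginv G g) \<omega>)) \<rparr>"

text \<open>The map \<open>\<psi>\<^sub>x\<close> between fibres over \<open>x\<close> induced by \<open>\<psi>\<close>, i.e. \<open>\<psi>\<^sub>x(a\<^sub>x) = \<psi>(a)\<^sub>x\<close>.\<close>

definition fibre_map ::
    "('h, 'a, 'f) gpd_algebra \<Rightarrow> ('h, 'b, 'e) gpd_algebra \<Rightarrow> ('a \<Rightarrow> 'b) \<Rightarrow> 'h \<Rightarrow> 'f \<Rightarrow> 'e" where
  "fibre_map A B \<psi> x v =
     (THE w. \<exists>a \<in> alg_set (alg_of A). proj A x a = v \<and> w = proj B x (\<psi> a))"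

text \<open>The maps below are extensional: they carry their domain, outside which they are
  \<open>undefined\<close>.\<close>

definition Ind_map ::
    "'g groupoid \<Rightarrow> 'h groupoid \<Rightarrow> ('o, 'g, 'h) correspondence
      \<Rightarrow> ('h, 'a, 'f) gpd_algebra \<Rightarrow> ('h, 'b, 'e) gpd_algebra \<Rightarrow> ('a \<Rightarrow> 'b)
      \<Rightarrow> ('o \<Rightarrow> 'f) \<Rightarrow> ('o \<Rightarrow> 'e)" where
  "Ind_map G H \<Omega> A B \<psi> =
     (\<lambda>\<xi>\<in>alg_set (alg_of (Ind G H \<Omega> A)). \<lambda>\<omega>\<in>topspace (ctop \<Omega>).
        fibre_map A B \<psi> (ranchor \<Omega> \<omega>) (\<xi> \<omega>))"

text \<open>The homomorphism \<open>\<rho>*\<close> from \<open>C\<^sub>0(G\<^sup>0)\<close> to the algebra induced from \<open>C\<^sub>0(H\<^sup>0)\<close>, for a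
  proper correspondence.\<close>

definition anchor_pullback ::
    "'g groupoid \<Rightarrow> ('o, 'g, 'h) correspondence \<Rightarrow> ('g \<Rightarrow> complex) \<Rightarrow> ('o \<Rightarrow> complex)" where
  "anchor_pullback G \<Omega> =
     (\<lambda>f\<in>alg_set (alg_of (C0_algebra G)). \<lambda>\<omega>\<in>topspace (ctop \<Omega>). f (lanchor \<Omega> \<omega>))"

text \<open>The map \<open>\<phi>\<^sub>A\<close> given by \<open>\<phi>\<^sub>A(\<xi>)[\<omega>, l] = \<xi>(\<omega>)(l)\<close>.\<close>

definition Ind_comp_iso ::
    "'g groupoid \<Rightarrow> 'h groupoid \<Rightarrow> 'k groupoid
      \<Rightarrow> ('o, 'g, 'h) correspondence \<Rightarrow> ('l, 'h, 'k) correspondence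
      \<Rightarrow> ('k, 'a, 'f) gpd_algebra \<Rightarrow> ('o \<Rightarrow> 'l \<Rightarrow> 'f) \<Rightarrow> (('o \<times> 'l) set \<Rightarrow> 'f)" where
  "Ind_comp_iso G H K \<Omega> \<Lambda> A =
     (\<lambda>\<xi>\<in>alg_set (alg_of (Ind G H \<Omega> (Ind H K \<Lambda> A))).
        \<lambda>z\<in>topspace (ctop (corr_comp H \<Lambda> \<Omega>)). lift_class (\<lambda>(\<omega>, l). \<xi> \<omega> l) z)"

end

theory Submission
  imports Defs
begin

text \<open>Evaluated at a class \<open>[\<omega>, l]\<close>, both sides of the identity are \<open>f (\<rho> \<omega>)\<close>: the pullback of \<open>f\<close> to \<open>\<Omega>\<close> is
the function \<open>\<omega> \<mapsto> f (\<rho> \<omega>)\<close>, the map induced by the pullback along the anchor of \<open>\<Lambda>\<close> replaces the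
scalar \<open>c = f (\<rho> \<omega>)\<close> by the constant function \<open>c\<close> on the fibre of \<open>\<Lambda>\<close> over \<open>\<sigma> \<omega>\<close>, the isomorphism
evaluates this constant at \<open>l\<close>, and the left anchor of the composition sends \<open>[\<omega>, l]\<close> to \<open>\<rho> \<omega>\<close>.
The scalar is replaced by a constant because every complex number is the value at a prescribed unit
of some function in \<open>C\<^sub>0(H\<^sup>0)\<close> (\<open>C0_functions_attain_value\<close>, \<open>fibre_map_anchor_pullback\<close>).

The substance lies in showing that each of the three maps takes values in the induced algebra that it
should.

For the pullback along the anchor of a proper correspondence, vanishing at infinity is the
compactness of preimages of compact sets under \<open>\<Omega>/H \<rightarrow> G\<^sup>0\<close>; continuity of a section of a bundle with
fibres \<open>\<complex>\<close> is ordinary continuity (\<open>continuous_map_C0_bundle_iff\<close>).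

For the induced map, the fibrewise constant section must be continuous into the bundle of the algebra
induced along \<open>\<Lambda>\<close>. This amounts to upper semicontinuity of the norm of \<open>c - a\<close> on the fibres
of \<open>\<Lambda>\<close>, which holds because \<open>\<Lambda>/K \<rightarrow> H\<^sup>0\<close> is a closed map (\<open>fibre_norm_upper_semicontinuous\<close>).

For the isomorphism, continuity follows by comparing a section near a point with a single element of
the induced algebra having the same value there (\<open>continuous_map_Ind_Ind_eval\<close>). Vanishing at infinity
requires that the part of \<open>(\<Omega> \<times>\<^sub>H \<Lambda>)/K\<close> lying over a compact subset of \<open>\<Omega>/H\<close> is contained in a compact
set (\<open>compactin_composite_quotient_over\<close>). Such a set is the image of a fibre product of compact
sets of representatives, and these exist since the spaces are locally compact and orbit maps are
open (\<open>open_map_orbit\<close>).\<close>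

section \<open>Quotients, local homeomorphisms and functions vanishing at infinity\<close>

lemma lift_class_eq:
  assumes "x \<in> z" "\<And>y. y \<in> z \<Longrightarrow> f y = c"
  shows "lift_class f z = c"
proof -
  have "f ` z = {c}" using assms by force
  then show ?thesis by (simp add: lift_class_def)
qed

lemma topspace_quotient_topology [simp]: "topspace (quotient_topology X q) = q ` topspace X"
proof
  have "{x \<in> topspace X. q x \<in> q ` topspace X} = topspace X" by blast
  then have "openin (quotient_topology X q) (q ` topspace X)"
    by (simp add: openin_quotient_topology)
  then show "q ` topspace X \<subseteq> topspace (quotient_topology X q)" by (rule openin_subset)
  show "topspace (quotient_topology X q) \<subseteq> q ` topspace X"
    using openin_topspace openin_quotient_topology by metis
qed

lemma quotient_map_quotient_topology: "quotient_map X (quotient_topology X q) q"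
  by (simp add: quotient_map_def openin_quotient_topology)

lemma continuous_map_complex_iff:
  fixes f :: "'x \<Rightarrow> complex"
  shows "continuous_map X euclidean f \<longleftrightarrow>
    (\<forall>x\<in>topspace X. \<forall>\<epsilon>>0. \<exists>U. openin X U \<and> x \<in> U \<and> (\<forall>y\<in>U. cmod (f y - f x) < \<epsilon>))"
  unfolding mtopology_is_euclidean[symmetric] Met_TC.continuous_map_to_metric
  by (simp add: dist_norm norm_minus_commute)

lemma open_map_local_homeomorphism:
  assumes "local_homeomorphism X Y f"
  shows "open_map X Y f"
  unfolding open_map_def
proof (intro allI impI)
  fix W assume W: "openin X W"
  have "\<exists>T. openin Y T \<and> y \<in> T \<and> T \<subseteq> f ` W" if y: "y \<in> f ` W" for y
  proof -
    from y obtain x where x: "x \<in> W" "y = f x" by blast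
    then have "x \<in> topspace X" using W openin_subset by blast
    then obtain U where U: "openin X U" "x \<in> U" "openin Y (f ` U)"
      and hom: "homeomorphic_map (subtopology X U) (subtopology Y (f ` U)) f"
      using assms unfolding local_homeomorphism_def by blast
    have "openin (subtopology X U) (W \<inter> U)"
      using W by (simp add: openin_subtopology_Int)
    then have "openin (subtopology Y (f ` U)) (f ` (W \<inter> U))"
      using homeomorphic_imp_open_map[OF hom] by (simp add: open_map_def)
    then have "openin Y (f ` (W \<inter> U))" using U(3) openin_trans_full by blast
    then show ?thesis using x U by blast
  qed
  then show "openin Y (f ` W)" by (subst openin_subopen) blast
qed

lemma locally_compact_space_local_homeomorphism:
  assumes "local_homeomorphism X Y f" "locally_compact_space Y" "Hausdorff_space Y"
  shows "locally_compact_space X"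
  unfolding locally_compact_space_def
proof
  fix x assume "x \<in> topspace X"
  then obtain U where U: "openin X U" "x \<in> U" "openin Y (f ` U)"
    and hom: "homeomorphic_map (subtopology X U) (subtopology Y (f ` U)) f"
    using assms unfolding local_homeomorphism_def by blast
  have "locally_compact_space (subtopology Y (f ` U))"
    using assms U(3) locally_compact_space_open_subset by blast
  then have "locally_compact_space (subtopology X U)"
    by (rule iffD2[OF homeomorphic_locally_compact_space[OF
          homeomorphic_map_imp_homeomorphic_space[OF hom]]])
  moreover have "x \<in> topspace (subtopology X U)" using \<open>x \<in> topspace X\<close> U(2) by simp
  ultimately obtain V C where VC: "openin (subtopology X U) V" "compactin (subtopology X U) C"
      "x \<in> V" "V \<subseteq> C"
    unfolding locally_compact_space_def by blast
  have "openin X V" using VC(1) U(1) by (rule openin_trans_full)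
  moreover have "compactin X C" using VC(2) by (simp add: compactin_subtopology)
  ultimately show "\<exists>V C. openin X V \<and> compactin X C \<and> x \<in> V \<and> V \<subseteq> C"
    using VC(3,4) by blast
qed

text \<open>The images of the open sets with compact neighbourhoods cover \<open>C\<close>; a finite subcover provides the
compact lift.\<close>

lemma compactin_lift_open_map:
  assumes open_q: "open_map X Y q" and "q ` topspace X = topspace Y"
    and lc: "locally_compact_space X" and C: "compactin Y C"
  obtains N where "compactin X N" "C \<subseteq> q ` N"
proof -
  define \<U> where "\<U> = {q ` U | U. openin X U \<and> (\<exists>N. compactin X N \<and> U \<subseteq> N)}"
  have open_U: "openin Y V" if "V \<in> \<U>" for V
    using that open_q unfolding \<U>_def open_map_def by blast
  have "C \<subseteq> \<Union>\<U>"
  proof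
    fix y assume "y \<in> C"
    then obtain x where x: "x \<in> topspace X" "y = q x"
      using compactin_subset_topspace[OF C] assms(2) by blast
    then obtain U N where "openin X U" "compactin X N" "x \<in> U" "U \<subseteq> N"
      using lc unfolding locally_compact_space_def by blast
    then show "y \<in> \<Union>\<U>" using x unfolding \<U>_def by blast
  qed
  with C open_U have "\<exists>\<F>. finite \<F> \<and> \<F> \<subseteq> \<U> \<and> C \<subseteq> \<Union>\<F>"
    by (rule compactinD)
  then obtain \<F> where \<F>: "finite \<F>" "\<F> \<subseteq> \<U>" "C \<subseteq> \<Union>\<F>"
    by (elim exE conjE)
  have "\<exists>N. compactin X N \<and> V \<subseteq> q ` N" if "V \<in> \<F>" for V
  proof -
    from that \<F>(2) have "V \<in> \<U>" by (rule subsetD[rotated])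
    then obtain U N where "V = q ` U" "compactin X N" "U \<subseteq> N"
      unfolding \<U>_def by blast
    then show ?thesis by blast
  qed
  then obtain N where N: "\<And>V. V \<in> \<F> \<Longrightarrow> compactin X (N V)" "\<And>V. V \<in> \<F> \<Longrightarrow> V \<subseteq> q ` N V"
    by metis
  have "compactin X (\<Union>V\<in>\<F>. N V)" using \<F>(1) N(1) by (intro compactin_Union) auto
  moreover have "C \<subseteq> q ` (\<Union>V\<in>\<F>. N V)"
  proof
    fix y assume "y \<in> C"
    then obtain V where "V \<in> \<F>" "y \<in> V" using \<F>(3) by blast
    then show "y \<in> q ` (\<Union>V\<in>\<F>. N V)" using N(2)[of V] by blast
  qed
  ultimately show thesis by (rule that)
qed

lemma C0_functions_continuous: "f \<in> C0_functions X \<Longrightarrow> continuous_map X euclidean f"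
  by (simp add: C0_functions_def)

text \<open>A locally compact Hausdorff space is completely regular, so a bump function at \<open>x\<close> that vanishes
outside a compact neighbourhood can be scaled to the value \<open>v\<close>.\<close>

lemma C0_functions_attain_value:
  fixes v :: complex
  assumes lc: "locally_compact_space X" and Hd: "Hausdorff_space X" and x: "x \<in> topspace X"
  obtains a where "a \<in> C0_functions X" "a x = v"
proof -
  obtain U C where UC: "openin X U" "compactin X C" "x \<in> U" "U \<subseteq> C"
    using lc x unfolding locally_compact_space_def by blast
  have "completely_regular_space X"
    using lc Hd locally_compact_Hausdorff_imp_regular_space
      locally_compact_regular_imp_completely_regular_space by blast
  moreover have "closedin X (topspace X - U)" "x \<in> topspace X - (topspace X - U)"
    using UC x by auto
  ultimately obtain f where f: "continuous_map X (top_of_set {0..1::real}) f" "f x = 0"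
      "f ` (topspace X - U) \<subseteq> {1}"
    unfolding completely_regular_space_def by blast
  have contf: "continuous_map X euclideanreal f"
    using f(1) continuous_map_into_fulltopology by blast
  define a where "a = (\<lambda>y\<in>topspace X. v * complex_of_real (1 - f y))"
  have "continuous_map euclideanreal (euclidean :: complex topology)
      (\<lambda>t. v * complex_of_real (1 - t))"
    by (auto intro!: continuous_intros)
  from continuous_map_compose[OF contf this]
  have "continuous_map X euclidean (\<lambda>y. v * complex_of_real (1 - f y))"
    by (simp add: o_def)
  then have "continuous_map X euclidean a"
    by (rule continuous_map_eq) (simp add: a_def)
  moreover have "vanishes_at_infinity X (\<lambda>y. cmod (a y))"
    unfolding vanishes_at_infinity_def
  proof (intro allI impI exI conjI ballI)
    show "compactin X C" by (rule UC)
    fix \<epsilon> :: real and y assume "0 < \<epsilon>" "y \<in> topspace X - C"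
    moreover from this have "f y = 1" using UC(4) f(3) by blast
    ultimately show "\<bar>cmod (a y)\<bar> < \<epsilon>" by (simp add: a_def)
  qed
  ultimately have "a \<in> C0_functions X" by (simp add: C0_functions_def a_def)
  moreover have "a x = v" using x f(2) by (simp add: a_def)
  ultimately show thesis using that by blast
qed

lemma C0_functions_zero: "(\<lambda>x\<in>topspace X. 0) \<in> C0_functions X"
proof -
  have "continuous_map X euclidean (\<lambda>x\<in>topspace X. 0 :: complex)"
    by (rule continuous_map_eq[of _ _ "\<lambda>x. 0"]) auto
  then show ?thesis
    by (auto simp: C0_functions_def vanishes_at_infinity_def intro!: exI[of _ "{}"])
qed

lemma C0_functions_bounded:
  assumes "f \<in> C0_functions X"
  shows "\<exists>B. \<forall>x\<in>topspace X. cmod (f x) \<le> B"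
proof -
  have cont: "continuous_map X euclidean f" using assms by (simp add: C0_functions_def)
  have "\<exists>C. compactin X C \<and> (\<forall>x\<in>topspace X - C. \<bar>cmod (f x)\<bar> < 1)"
    using assms zero_less_one by (auto simp: C0_functions_def vanishes_at_infinity_def)
  then obtain C where C: "compactin X C" "\<And>x. x \<in> topspace X - C \<Longrightarrow> cmod (f x) < 1"
    by auto
  have "bounded (f ` C)"
    using image_compactin[OF C(1) cont] by (simp add: compact_imp_bounded)
  then obtain B where B: "\<And>y. y \<in> f ` C \<Longrightarrow> cmod y \<le> B" by (auto simp: bounded_iff)
  then have "cmod (f x) \<le> max B 1" if "x \<in> topspace X" for x
    using B C(2)[of x] that by (cases "x \<in> C") (auto simp: le_max_iff_disj)
  then show ?thesis by blast
qed

section \<open>Groupoids and orbits\<close>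

context topological_groupoid
begin

lemma inv_unique:
  assumes g: "g \<in> arrows G" and k: "k \<in> arrows G" "gsrc G g = grng G k" and gk: "gmul G g k = grng G g"
  shows "ginv G g = k"
proof -
  have "k = gmul G (gmul G (ginv G g) g) k" using g k by (simp add: inv_mul unit_mul)
  also have "\<dots> = gmul G (ginv G g) (gmul G g k)"
    using g k by (intro mul_assoc) (simp_all add: inv_closed src_inv)
  also have "\<dots> = ginv G g"
    using mul_unit[OF inv_closed[OF g]] g by (simp add: gk src_inv)
  finally show ?thesis by simp
qed

lemma inv_inv: "g \<in> arrows G \<Longrightarrow> ginv G (ginv G g) = g"
  by (rule inv_unique) (simp_all add: inv_closed src_inv rng_inv inv_mul)

lemma inv_of_unit: "x \<in> gunits G \<Longrightarrow> ginv G x = x"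
  using units_subset unit_mul[of x]
  by (intro inv_unique) (auto simp: rng_of_unit src_of_unit)

lemma inv_gmul:
  assumes g: "g \<in> arrows G" and h: "h \<in> arrows G" and gh: "gsrc G g = grng G h"
  shows "ginv G (gmul G g h) = gmul G (ginv G h) (ginv G g)"
proof (rule inv_unique)
  have k: "gmul G (ginv G h) (ginv G g) \<in> arrows G" "grng G (gmul G (ginv G h) (ginv G g)) = gsrc G h"
    using assms by (simp_all add: mul_closed inv_closed src_inv rng_inv rng_mul)
  have "gmul G h (gmul G (ginv G h) (ginv G g)) = gmul G (gmul G h (ginv G h)) (ginv G g)"
    using assms by (simp add: mul_assoc inv_closed src_inv rng_inv)
  also have "\<dots> = ginv G g"
    using unit_mul[OF inv_closed[OF g]] assms by (simp add: mul_inv rng_inv)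
  finally have "gmul G (gmul G g h) (gmul G (ginv G h) (ginv G g)) = gmul G g (ginv G g)"
    using assms k by (simp add: mul_assoc)
  then show "gmul G (gmul G g h) (gmul G (ginv G h) (ginv G g)) = grng G (gmul G g h)"
    using assms by (simp add: mul_inv rng_mul)
qed (use assms in \<open>simp_all add: mul_closed inv_closed src_inv rng_inv src_mul rng_mul\<close>)

end

lemma (in topological_groupoid) topspace_unit_space: "topspace (unit_space G) = gunits G"
  using units_subset by auto

text \<open>The algebra of a right action on a bare set, on which the orbits depend. It applies to \<open>\<Omega>\<close> and \<open>\<Lambda>\<close>,
to the diagonal action on their fibre product, and to the action of \<open>K\<close> on the composition.\<close>

locale orbit_action = topological_groupoid H for H :: "'h groupoid" +
  fixes S :: "'x set" and \<sigma> :: "'x \<Rightarrow> 'h" and act :: "'x \<Rightarrow> 'h \<Rightarrow> 'x"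
  assumes act_closed: "\<lbrakk>x \<in> S; h \<in> arrows H; \<sigma> x = grng H h\<rbrakk> \<Longrightarrow> act x h \<in> S"
    and anchor_unit: "x \<in> S \<Longrightarrow> \<sigma> x \<in> gunits H"
    and anchor_act: "\<lbrakk>x \<in> S; h \<in> arrows H; \<sigma> x = grng H h\<rbrakk> \<Longrightarrow> \<sigma> (act x h) = gsrc H h"
    and act_mul:
      "\<lbrakk>x \<in> S; g \<in> arrows H; h \<in> arrows H; \<sigma> x = grng H g; gsrc H g = grng H h\<rbrakk>
        \<Longrightarrow> act x (gmul H g h) = act (act x g) h"
    and act_unit: "x \<in> S \<Longrightarrow> act x (\<sigma> x) = x"
begin

abbreviation orbit :: "'x \<Rightarrow> 'x set" where
  "orbit \<equiv> right_orbit H \<sigma> act"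

lemma anchor_arrow: "x \<in> S \<Longrightarrow> \<sigma> x \<in> arrows H"
  using anchor_unit units_subset by blast

lemma mem_orbit_act: "\<lbrakk>h \<in> arrows H; \<sigma> x = grng H h\<rbrakk> \<Longrightarrow> act x h \<in> orbit x"
  unfolding right_orbit_def by auto

lemma mem_orbit_self: "x \<in> S \<Longrightarrow> x \<in> orbit x"
  using mem_orbit_act[of "\<sigma> x" x] by (simp add: act_unit anchor_arrow rng_of_unit anchor_unit)

lemma mem_orbitE:
  assumes "y \<in> orbit x"
  obtains h where "h \<in> arrows H" "\<sigma> x = grng H h" "y = act x h"
  using assms unfolding right_orbit_def by auto

lemma orbit_act:
  assumes x: "x \<in> S" and h: "h \<in> arrows H" "\<sigma> x = grng H h"
  shows "orbit (act x h) = orbit x"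
proof
  show "orbit (act x h) \<subseteq> orbit x"
  proof
    fix y assume "y \<in> orbit (act x h)"
    then obtain k where k: "k \<in> arrows H" "\<sigma> (act x h) = grng H k" "y = act (act x h) k"
      by (rule mem_orbitE)
    then have "y = act x (gmul H h k)" using x h by (simp add: act_mul anchor_act)
    moreover have "gmul H h k \<in> arrows H" "\<sigma> x = grng H (gmul H h k)"
      using x h k by (simp_all add: mul_closed rng_mul anchor_act)
    ultimately show "y \<in> orbit x" by (simp add: mem_orbit_act)
  qed
  show "orbit x \<subseteq> orbit (act x h)"
  proof
    fix y assume "y \<in> orbit x"
    then obtain k where k: "k \<in> arrows H" "\<sigma> x = grng H k" "y = act x k"
      by (rule mem_orbitE)
    let ?k = "gmul H (ginv H h) k"
    have k': "?k \<in> arrows H" "grng H ?k = gsrc H h"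
      using h k by (simp_all add: mul_closed rng_mul inv_closed src_inv rng_inv)
    have "gmul H h ?k = gmul H (gmul H h (ginv H h)) k"
      using h k by (simp add: mul_assoc inv_closed src_inv rng_inv)
    also have "\<dots> = gmul H (grng H k) k" using h k by (simp add: mul_inv)
    also have "\<dots> = k" using k by (simp add: unit_mul)
    finally have "act (act x h) ?k = y"
      using act_mul[OF x h(1) k'(1) h(2)] k' k(3) by simp
    then show "y \<in> orbit (act x h)"
      using mem_orbit_act[OF k'(1), of "act x h"] k' anchor_act[OF x h] by simp
  qed
qed

lemma orbit_eqD: "\<lbrakk>y \<in> S; orbit x = orbit y\<rbrakk> \<Longrightarrow> \<exists>h. h \<in> arrows H \<and> \<sigma> x = grng H h \<and> y = act x h"
  using mem_orbit_self mem_orbitE by metis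

lemma lift_class_orbit:
  assumes "x \<in> S" and "\<And>h. \<lbrakk>h \<in> arrows H; \<sigma> x = grng H h\<rbrakk> \<Longrightarrow> f (act x h) = f x"
  shows "lift_class f (orbit x) = f x"
  using assms by (intro lift_class_eq[OF mem_orbit_self]) (auto elim: mem_orbitE)

end

section \<open>Correspondences and their orbit spaces\<close>

context etale_correspondence
begin

sublocale right_orbits: orbit_action H "topspace (ctop \<Omega>)" "ranchor \<Omega>" "ract \<Omega>"
proof
  fix x h assume x: "x \<in> topspace (ctop \<Omega>)" and h: "h \<in> arrows H" "ranchor \<Omega> x = grng H h"
  have "(x, h) \<in> topspace (subtopology (prod_topology (ctop \<Omega>) (gtop H))
      {(x, h). ranchor \<Omega> x = grng H h})"
    using x h by simp
  then have "(\<lambda>(x, h). ract \<Omega> x h) (x, h) \<in> topspace (ctop \<Omega>)"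
    using right.continuous_act by (meson continuous_map_image_subset_topspace image_subset_iff)
  then show "ract \<Omega> x h \<in> topspace (ctop \<Omega>)" by simp
next
  fix x assume "x \<in> topspace (ctop \<Omega>)"
  then have "ranchor \<Omega> x \<in> topspace (unit_space H)"
    using right.continuous_anchor by (meson continuous_map_image_subset_topspace image_subset_iff)
  then show "ranchor \<Omega> x \<in> gunits H" by simp
qed (simp_all add: right.anchor_act right.act_mul right.act_unit)

lemma lact_closed:
  assumes "x \<in> topspace (ctop \<Omega>)" "g \<in> arrows G" "gsrc G g = lanchor \<Omega> x"
  shows "lact \<Omega> g x \<in> topspace (ctop \<Omega>)"
proof -
  have "(g, x) \<in> topspace (subtopology (prod_topology (gtop G) (ctop \<Omega>))
      {(g, x). gsrc G g = lanchor \<Omega> x})"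
    using assms by simp
  then have "(\<lambda>(g, x). lact \<Omega> g x) (g, x) \<in> topspace (ctop \<Omega>)"
    using left.continuous_act by (meson continuous_map_image_subset_topspace image_subset_iff)
  then show ?thesis by simp
qed

lemma lanchor_unit:
  assumes "x \<in> topspace (ctop \<Omega>)"
  shows "lanchor \<Omega> x \<in> gunits G"
proof -
  have "lanchor \<Omega> x \<in> topspace (unit_space G)"
    using assms left.continuous_anchor by (meson continuous_map_image_subset_topspace image_subset_iff)
  then show ?thesis by simp
qed

lemma quotient_map_orbit: "quotient_map (ctop \<Omega>) (corr_quotient H \<Omega>) right_orbits.orbit"
  unfolding corr_quotient_def orbit_space_def by (rule quotient_map_quotient_topology)

lemma topspace_corr_quotient: "topspace (corr_quotient H \<Omega>) = right_orbits.orbit ` topspace (ctop \<Omega>)"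
  using quotient_imp_surjective_map[OF quotient_map_orbit] by simp

text \<open>A point \<open>x\<close> lies in the saturation of \<open>W\<close> if and only if some \<open>h\<close> with range \<open>\<sigma> x\<close> moves it into \<open>W\<close>. If
\<open>A \<times> B\<close> is a neighbourhood of \<open>(x, h)\<close> whose composable pairs act into \<open>W\<close>, then the points
of \<open>A\<close> with anchor in the range of \<open>B\<close> belong to the saturation. They form a neighbourhood of \<open>x\<close> because the
range map, being a local homeomorphism, is open.\<close>

lemma open_map_orbit: "open_map (ctop \<Omega>) (corr_quotient H \<Omega>) right_orbits.orbit"
  unfolding open_map_def
proof (intro allI impI)
  fix W assume W: "openin (ctop \<Omega>) W"
  then have WX: "W \<subseteq> topspace (ctop \<Omega>)" by (rule openin_subset)
  let ?fp = "{(x, h). ranchor \<Omega> x = grng H h}"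
  let ?P = "{p \<in> topspace (subtopology (prod_topology (ctop \<Omega>) (gtop H)) ?fp).
      (\<lambda>(x, h). ract \<Omega> x h) p \<in> W}"
  have "openin (subtopology (prod_topology (ctop \<Omega>) (gtop H)) ?fp) ?P"
    by (rule openin_continuous_map_preimage[OF right.continuous_act W])
  then obtain T where T: "openin (prod_topology (ctop \<Omega>) (gtop H)) T" and PT: "?P = T \<inter> ?fp"
    unfolding openin_subtopology by blast
  let ?Q = "{x \<in> topspace (ctop \<Omega>). right_orbits.orbit x \<in> right_orbits.orbit ` W}"
  have "\<exists>V. openin (ctop \<Omega>) V \<and> x \<in> V \<and> V \<subseteq> ?Q" if x: "x \<in> ?Q" for x
  proof -
    obtain w where w: "w \<in> W" "right_orbits.orbit x = right_orbits.orbit w" using x by blast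
    then obtain h where h: "h \<in> arrows H" "ranchor \<Omega> x = grng H h" "w = ract \<Omega> x h"
      using right_orbits.orbit_eqD[of w x] WX by blast
    then have "(x, h) \<in> T \<inter> ?fp" unfolding PT[symmetric] using x w by simp
    then have "(x, h) \<in> T" by simp
    from T[unfolded openin_prod_topology_alt, rule_format, OF this]
    obtain A B where AB: "openin (ctop \<Omega>) A" "openin (gtop H) B" "x \<in> A" "h \<in> B" "A \<times> B \<subseteq> T"
      by (elim exE conjE)
    have rB: "openin (unit_space H) (grng H ` B)"
      using open_map_local_homeomorphism[OF H.etale_rng] AB(2) by (simp add: open_map_def)
    let ?V = "A \<inter> {y \<in> topspace (ctop \<Omega>). ranchor \<Omega> y \<in> grng H ` B}"
    have "openin (ctop \<Omega>) ?V"
      using AB(1) openin_continuous_map_preimage[OF right.continuous_anchor rB] by blast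
    moreover have "x \<in> ?V" using AB h x by auto
    moreover have "?V \<subseteq> ?Q"
    proof
      fix y assume y: "y \<in> ?V"
      then obtain k where k: "k \<in> B" "ranchor \<Omega> y = grng H k" by blast
      have kH: "k \<in> arrows H" using k AB(2) openin_subset by blast
      have "(y, k) \<in> T \<inter> ?fp" using y k AB(5) by auto
      then have "ract \<Omega> y k \<in> W" unfolding PT[symmetric] by simp
      moreover have "right_orbits.orbit (ract \<Omega> y k) = right_orbits.orbit y"
        using y k kH by (intro right_orbits.orbit_act) auto
      ultimately have "right_orbits.orbit y \<in> right_orbits.orbit ` W" by (metis imageI)
      then show "y \<in> ?Q" using y by simp
    qed
    ultimately show ?thesis by blast
  qed
  then have "openin (ctop \<Omega>) ?Q" by (subst openin_subopen) blast
  then show "openin (corr_quotient H \<Omega>) (right_orbits.orbit ` W)"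
    unfolding corr_quotient_def orbit_space_def openin_quotient_topology using WX by blast
qed

lemma lift_class_lanchor:
  "x \<in> topspace (ctop \<Omega>) \<Longrightarrow> lift_class (lanchor \<Omega>) (right_orbits.orbit x) = lanchor \<Omega> x"
  by (rule right_orbits.lift_class_orbit) (simp_all add: lanchor_ract)

text \<open>A saturated closed set has closed image in the orbit space, and the map from there to the unit
space is closed.\<close>

lemma closedin_lanchor_image:
  assumes proper: "proper_correspondence G H \<Omega>" and D: "closedin (ctop \<Omega>) D"
    and inv: "\<And>x h. \<lbrakk>x \<in> topspace (ctop \<Omega>); h \<in> arrows H; ranchor \<Omega> x = grng H h; ract \<Omega> x h \<in> D\<rbrakk> \<Longrightarrow> x \<in> D"
  shows "closedin (unit_space G) (lanchor \<Omega> ` D)"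
proof -
  have DX: "D \<subseteq> topspace (ctop \<Omega>)" by (rule closedin_subset[OF D])
  have "right_orbits.orbit ` topspace (ctop \<Omega>) - right_orbits.orbit ` D
      = right_orbits.orbit ` (topspace (ctop \<Omega>) - D)"
  proof
    show "right_orbits.orbit ` topspace (ctop \<Omega>) - right_orbits.orbit ` D
      \<subseteq> right_orbits.orbit ` (topspace (ctop \<Omega>) - D)" by blast
    show "right_orbits.orbit ` (topspace (ctop \<Omega>) - D)
      \<subseteq> right_orbits.orbit ` topspace (ctop \<Omega>) - right_orbits.orbit ` D"
    proof (clarify, intro conjI DiffI)
      fix x assume x: "x \<in> topspace (ctop \<Omega>)" "x \<notin> D"
      show "right_orbits.orbit x \<in> right_orbits.orbit ` topspace (ctop \<Omega>)" using x by blast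
      show "right_orbits.orbit x \<notin> right_orbits.orbit ` D"
      proof
        assume "right_orbits.orbit x \<in> right_orbits.orbit ` D"
        then obtain d where "d \<in> D" "right_orbits.orbit x = right_orbits.orbit d" by blast
        then show False using right_orbits.orbit_eqD[of d x] DX inv x by blast
      qed
    qed
  qed
  moreover have "openin (corr_quotient H \<Omega>) (right_orbits.orbit ` (topspace (ctop \<Omega>) - D))"
    using open_map_orbit D by (simp add: open_map_def openin_diff)
  ultimately have "closedin (corr_quotient H \<Omega>) (right_orbits.orbit ` D)"
    unfolding closedin_def topspace_corr_quotient using DX by auto
  then have "closedin (unit_space G) (lift_class (lanchor \<Omega>) ` right_orbits.orbit ` D)"
    using proper unfolding proper_correspondence_def proper_map_def closed_map_def by blast
  moreover have "lift_class (lanchor \<Omega>) ` right_orbits.orbit ` D = lanchor \<Omega> ` D"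
    unfolding image_image using DX lift_class_lanchor by (intro image_cong) auto
  ultimately show ?thesis by simp
qed

text \<open>\<open>\<Omega>\<close> inherits local compactness from the units of \<open>H\<close> through the local homeomorphism \<open>\<sigma>\<close>, so compact
sets lift along the open orbit map.\<close>

lemma compactin_orbit_representatives:
  assumes "compactin (corr_quotient H \<Omega>) C"
  shows "\<exists>N. compactin (ctop \<Omega>) N \<and>
    (\<forall>x\<in>topspace (ctop \<Omega>). right_orbits.orbit x \<in> C \<longrightarrow>
      (\<exists>n\<in>N. \<exists>h\<in>arrows H. ranchor \<Omega> n = grng H h \<and> x = ract \<Omega> n h))"
proof -
  have "locally_compact_space (ctop \<Omega>)"
    using locally_compact_space_local_homeomorphism[OF right_etale]
      H.locally_compact_units H.Hausdorff_units by blast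
  from compactin_lift_open_map[OF open_map_orbit topspace_corr_quotient[symmetric] this assms]
  obtain N where N: "compactin (ctop \<Omega>) N" "C \<subseteq> right_orbits.orbit ` N" .
  show ?thesis
  proof (intro exI conjI ballI impI)
    show "compactin (ctop \<Omega>) N" by (rule N(1))
    fix x assume x: "x \<in> topspace (ctop \<Omega>)" "right_orbits.orbit x \<in> C"
    then obtain n where "n \<in> N" "right_orbits.orbit n = right_orbits.orbit x" using N(2) by force
    then show "\<exists>n\<in>N. \<exists>h\<in>arrows H. ranchor \<Omega> n = grng H h \<and> x = ract \<Omega> n h"
      using right_orbits.orbit_eqD[OF x(1)] by blast
  qed
qed

lemma compactin_lanchor_preimage:
  assumes "proper_correspondence G H \<Omega>" "compactin (unit_space G) C"
  shows "compactin (corr_quotient H \<Omega>) {right_orbits.orbit x |x. x \<in> topspace (ctop \<Omega>) \<and> lanchor \<Omega> x \<in> C}"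
proof -
  have "{right_orbits.orbit x |x. x \<in> topspace (ctop \<Omega>) \<and> lanchor \<Omega> x \<in> C}
     = {z \<in> topspace (corr_quotient H \<Omega>). lift_class (lanchor \<Omega>) z \<in> C}"
    unfolding topspace_corr_quotient using lift_class_lanchor by auto
  then show ?thesis
    using compactin_proper_map_preimage[OF _ assms(2)] assms(1)
    unfolding proper_correspondence_def by simp
qed

lemma lact_inv:
  assumes "x \<in> topspace (ctop \<Omega>)" "g \<in> arrows G" "gsrc G g = lanchor \<Omega> x"
  shows "lact \<Omega> (ginv G g) (lact \<Omega> g x) = x"
proof -
  have "lact \<Omega> (ginv G g) (lact \<Omega> g x) = lact \<Omega> (gmul G (ginv G g) g) x"
    using assms by (intro left.act_mul[symmetric]) (simp_all add: G.inv_closed G.src_inv)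
  then show ?thesis using assms by (simp add: G.inv_mul left.act_unit)
qed

lemma lact_anchor_fibre:
  assumes g: "g \<in> arrows G"
  shows "lact \<Omega> g ` anchor_fibre \<Omega> (gsrc G g) = anchor_fibre \<Omega> (grng G g)"
proof
  have *: "lact \<Omega> g ` anchor_fibre \<Omega> (gsrc G g) \<subseteq> anchor_fibre \<Omega> (grng G g)"
    if "g \<in> arrows G" for g
    using that by (auto simp: anchor_fibre_def lact_closed left.anchor_act)
  show "lact \<Omega> g ` anchor_fibre \<Omega> (gsrc G g) \<subseteq> anchor_fibre \<Omega> (grng G g)" using g by (rule *)
  show "anchor_fibre \<Omega> (grng G g) \<subseteq> lact \<Omega> g ` anchor_fibre \<Omega> (gsrc G g)"
  proof
    fix x assume x: "x \<in> anchor_fibre \<Omega> (grng G g)"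
    have "lact \<Omega> (ginv G g) x \<in> anchor_fibre \<Omega> (gsrc G g)"
      using *[OF G.inv_closed[OF g]] x g by (auto simp: G.src_inv G.rng_inv)
    moreover have "lact \<Omega> g (lact \<Omega> (ginv G g) x) = x"
      using lact_inv[of x "ginv G g"] x g
      by (simp add: anchor_fibre_def G.inv_inv G.inv_closed G.src_inv)
    ultimately show "x \<in> lact \<Omega> g ` anchor_fibre \<Omega> (gsrc G g)" by force
  qed
qed

end

section \<open>Continuity into bundle topologies\<close>

text \<open>The tube of radius \<open>\<epsilon>\<close> around the section \<open>x \<mapsto> a\<^sub>x\<close> over \<open>U\<close>, a basic open set of the bundle topology.\<close>

definition bundle_tube ::
    "('g, 'a, 'f) gpd_algebra \<Rightarrow> 'a \<Rightarrow> 'g set \<Rightarrow> real \<Rightarrow> ('g \<times> 'f) set" where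
  "bundle_tube A a U \<epsilon> = {(x, v). x \<in> U \<and> v \<in> alg_set (fibre A x) \<and>
     alg_norm (fibre A x) (alg_add (fibre A x) v (alg_scale (fibre A x) (-1) (proj A x a))) < \<epsilon>}"

text \<open>The topology is generated by tubes that need not a priori cover the disjoint union of the fibres,
so a continuous map must in particular have values in some tube.\<close>

lemma continuous_map_bundle_iff:
  "continuous_map X (bundle_topology G A) s \<longleftrightarrow>
     (\<forall>x \<in> topspace X. \<exists>a U \<epsilon>. a \<in> alg_set (alg_of A) \<and> openin (unit_space G) U \<and> \<epsilon> > 0 \<and>
        s x \<in> bundle_tube A a U \<epsilon>) \<and>
     (\<forall>a U \<epsilon>. a \<in> alg_set (alg_of A) \<and> openin (unit_space G) U \<and> \<epsilon> > 0 \<longrightarrow>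
        openin X {x \<in> topspace X. s x \<in> bundle_tube A a U \<epsilon>})"
proof -
  have preimage: "s -` T \<inter> topspace X = {x \<in> topspace X. s x \<in> T}" for T by blast
  show ?thesis
    unfolding bundle_topology_def bundle_tube_def[symmetric] continuous_on_generated_topo_iff preimage
    by (auto simp: image_subset_iff) metis+
qed

lemma openin_bundle_tube_preimage:
  assumes "continuous_map X (bundle_topology G A) s"
    and "a \<in> alg_set (alg_of A)" "openin (unit_space G) U" "\<epsilon> > 0"
  shows "openin X {x \<in> topspace X. s x \<in> bundle_tube A a U \<epsilon>}"
  using assms unfolding continuous_map_bundle_iff by blast

lemma C0_algebra_simps [simp]:
  "alg_set (alg_of (C0_algebra G)) = C0_functions (unit_space G)"
  "fibre (C0_algebra G) x = complex_algebra"
  "proj (C0_algebra G) x a = a x"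
  "fibre_act (C0_algebra G) g v = v"
  by (simp_all add: C0_algebra_def section_algebra_def)

lemma complex_algebra_simps [simp]:
  "alg_set complex_algebra = UNIV"
  "alg_add complex_algebra = (+)"
  "alg_scale complex_algebra = (*)"
  "alg_norm complex_algebra = cmod"
  by (simp_all add: complex_algebra_def)

lemma bundle_tube_C0: "(x, v) \<in> bundle_tube (C0_algebra G) a U \<epsilon> \<longleftrightarrow> x \<in> U \<and> cmod (v - a x) < \<epsilon>"
  by (simp add: bundle_tube_def)

text \<open>The bundle of \<open>C\<^sub>0(G\<^sup>0)\<close> is the trivial one: near a point, a function \<open>a\<close> in \<open>C\<^sub>0(G\<^sup>0)\<close> with the value
\<open>f x\<close> at \<open>\<sigma> x\<close> is almost constant, and a small tube around it confines \<open>f\<close> to a small disc.\<close>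

lemma (in etale_groupoid) continuous_map_C0_bundle_iff:
  assumes \<sigma>: "continuous_map X (unit_space G) \<sigma>"
  shows "continuous_map X (bundle_topology G (C0_algebra G)) (\<lambda>x. (\<sigma> x, f x))
    \<longleftrightarrow> continuous_map X euclidean f"
proof
  assume L: "continuous_map X (bundle_topology G (C0_algebra G)) (\<lambda>x. (\<sigma> x, f x))"
  show "continuous_map X euclidean f"
    unfolding continuous_map_complex_iff
  proof (intro ballI allI impI)
    fix x and \<epsilon> :: real assume x: "x \<in> topspace X" and \<epsilon>: "\<epsilon> > 0"
    have \<sigma>x: "\<sigma> x \<in> topspace (unit_space G)"
      using continuous_map_image_subset_topspace[OF \<sigma>] x by blast
    obtain a where a: "a \<in> C0_functions (unit_space G)" "a (\<sigma> x) = f x"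
      using C0_functions_attain_value[OF locally_compact_units Hausdorff_units \<sigma>x] .
    have "continuous_map X euclidean (a \<circ> \<sigma>)"
      by (rule continuous_map_compose[OF \<sigma> C0_functions_continuous[OF a(1)]])
    from this[unfolded continuous_map_complex_iff, rule_format, OF x half_gt_zero[OF \<epsilon>]]
    obtain V where V: "openin X V" "x \<in> V" "\<And>y. y \<in> V \<Longrightarrow> cmod (a (\<sigma> y) - a (\<sigma> x)) < \<epsilon>/2"
      by auto
    \<comment> \<open>The tube extends over the whole unit space: shrinking to \<open>V\<close> is what makes \<open>a\<close> almost constant on it.\<close>
    let ?W = "{y \<in> topspace X. (\<sigma> y, f y) \<in> bundle_tube (C0_algebra G) a (topspace (unit_space G)) (\<epsilon>/2)}"
    have "openin X ?W"
      by (rule openin_bundle_tube_preimage[OF L]) (use a(1) \<epsilon> in \<open>simp_all del: topspace_subtopology\<close>)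
    moreover have "x \<in> ?W" using x \<sigma>x a(2) \<epsilon> by (simp add: bundle_tube_C0)
    moreover have "cmod (f y - f x) < \<epsilon>" if "y \<in> V \<inter> ?W" for y
    proof -
      have "cmod (f y - a (\<sigma> y)) < \<epsilon>/2" "cmod (a (\<sigma> y) - f x) < \<epsilon>/2"
        using that V(3)[of y] a(2) by (auto simp: bundle_tube_C0)
      then show ?thesis using norm_diff_triangle_less by fastforce
    qed
    ultimately show "\<exists>U. openin X U \<and> x \<in> U \<and> (\<forall>y\<in>U. cmod (f y - f x) < \<epsilon>)"
      using V(1,2) by (intro exI[of _ "V \<inter> ?W"]) (auto intro: openin_Int)
  qed
next
  assume f: "continuous_map X euclidean f"
  show "continuous_map X (bundle_topology G (C0_algebra G)) (\<lambda>x. (\<sigma> x, f x))"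
    unfolding continuous_map_bundle_iff bundle_tube_C0 C0_algebra_simps
  proof (intro conjI ballI allI impI)
    fix x assume x: "x \<in> topspace X"
    have \<sigma>x: "\<sigma> x \<in> topspace (unit_space G)"
      using continuous_map_image_subset_topspace[OF \<sigma>] x by blast
    let ?z = "\<lambda>y\<in>topspace (unit_space G). 0 :: complex"
    have "?z \<in> C0_functions (unit_space G)" by (rule C0_functions_zero)
    moreover have "cmod (f x - ?z (\<sigma> x)) < cmod (f x) + 1" using \<sigma>x by simp
    moreover have "0 < cmod (f x) + 1" by (simp add: add_nonneg_pos)
    ultimately show "\<exists>a U \<epsilon>. a \<in> C0_functions (unit_space G) \<and> openin (unit_space G) U \<and> 0 < \<epsilon> \<and>
        \<sigma> x \<in> U \<and> cmod (f x - a (\<sigma> x)) < \<epsilon>"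
      using \<sigma>x openin_topspace by blast
  next
    fix a U and \<epsilon> :: real
    assume asm: "a \<in> C0_functions (unit_space G) \<and> openin (unit_space G) U \<and> 0 < \<epsilon>"
    then have "continuous_map X euclidean (a \<circ> \<sigma>)"
      by (intro continuous_map_compose[OF \<sigma>] C0_functions_continuous) simp
    with f have "continuous_map X euclidean (\<lambda>x. cmod (f x - (a \<circ> \<sigma>) x))"
      by (intro continuous_map_norm continuous_map_diff)
    then have "openin X {x \<in> topspace X. cmod (f x - a (\<sigma> x)) \<in> {..<\<epsilon>}}"
      using openin_continuous_map_preimage[of X euclideanreal _ "{..<\<epsilon>}"] by simp
    moreover have "openin X {x \<in> topspace X. \<sigma> x \<in> U}"
      using openin_continuous_map_preimage[OF \<sigma>] asm by blast
    ultimately have "openin X ({x \<in> topspace X. \<sigma> x \<in> U} \<inter> {x \<in> topspace X. cmod (f x - a (\<sigma> x)) \<in> {..<\<epsilon>}})"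
      by (intro openin_Int)
    moreover have "{x \<in> topspace X. \<sigma> x \<in> U} \<inter> {x \<in> topspace X. cmod (f x - a (\<sigma> x)) \<in> {..<\<epsilon>}}
        = {x \<in> topspace X. \<sigma> x \<in> U \<and> cmod (f x - a (\<sigma> x)) < \<epsilon>}" by auto
    ultimately show "openin X {x \<in> topspace X. \<sigma> x \<in> U \<and> cmod (f x - a (\<sigma> x)) < \<epsilon>}" by simp
  qed
qed

section \<open>Algebras induced from complex functions\<close>

lemma Ind_sections_C0_iff:
  assumes "etale_groupoid H" "continuous_map (ctop \<Omega>) (unit_space H) (ranchor \<Omega>)"
  shows "\<xi> \<in> Ind_sections H \<Omega> (C0_algebra H) \<longleftrightarrow>
    \<xi> \<in> extensional (topspace (ctop \<Omega>)) \<and> continuous_map (ctop \<Omega>) euclidean \<xi> \<and>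
    (\<exists>B. \<forall>\<omega> \<in> topspace (ctop \<Omega>). cmod (\<xi> \<omega>) \<le> B) \<and>
    (\<forall>\<omega> \<in> topspace (ctop \<Omega>). \<forall>h \<in> arrows H. grng H h = ranchor \<Omega> \<omega> \<longrightarrow>
       \<xi> (ract \<Omega> \<omega> h) = \<xi> \<omega>) \<and>
    vanishes_at_infinity (corr_quotient H \<Omega>) (lift_class (\<lambda>\<omega>. cmod (\<xi> \<omega>)))"
  using etale_groupoid.continuous_map_C0_bundle_iff[OF assms]
  by (simp add: Ind_sections_def)

lemma alg_set_Ind: "alg_set (alg_of (Ind G H \<Omega> A)) = Ind_sections H \<Omega> A"
  by (simp add: Ind_def section_algebra_def)

text \<open>The norm of the fibres of an induced algebra of complex functions.\<close>

definition sup_cmod :: "'s set \<Rightarrow> ('s \<Rightarrow> complex) \<Rightarrow> real" where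
  "sup_cmod S v = Sup (insert 0 ((\<lambda>s. cmod (v s)) ` S))"

lemma sup_cmod_upper:
  assumes "\<And>s. s \<in> S \<Longrightarrow> cmod (v s) \<le> B" and "s \<in> S"
  shows "cmod (v s) \<le> sup_cmod S v"
  unfolding sup_cmod_def using assms
  by (intro cSup_upper bdd_aboveI[of _ "max 0 B"]) (auto simp: le_max_iff_disj)

lemma sup_cmod_nonneg:
  assumes "\<And>s. s \<in> S \<Longrightarrow> cmod (v s) \<le> B"
  shows "0 \<le> sup_cmod S v"
  unfolding sup_cmod_def using assms
  by (intro cSup_upper bdd_aboveI[of _ "max 0 B"]) (auto simp: le_max_iff_disj)

lemma sup_cmod_least:
  assumes "0 \<le> B" "\<And>s. s \<in> S \<Longrightarrow> cmod (v s) \<le> B"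
  shows "sup_cmod S v \<le> B"
  unfolding sup_cmod_def using assms by (intro cSup_least) auto

lemma sup_cmod_cong: "(\<And>s. s \<in> S \<Longrightarrow> v s = w s) \<Longrightarrow> sup_cmod S v = sup_cmod S w"
  unfolding sup_cmod_def by (simp cong: image_cong)

lemma Ind_C0_simps:
  "alg_set (fibre (Ind G H \<Omega> (C0_algebra H)) x)
     = (\<lambda>\<xi>. restrict \<xi> (anchor_fibre \<Omega> x)) ` Ind_sections H \<Omega> (C0_algebra H)"
  "proj (Ind G H \<Omega> (C0_algebra H)) x \<xi> = restrict \<xi> (anchor_fibre \<Omega> x)"
  "alg_norm (fibre (Ind G H \<Omega> (C0_algebra H)) x) v = sup_cmod (anchor_fibre \<Omega> x) v"
  "fibre_act (Ind G H \<Omega> (C0_algebra H)) g v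
     = (\<lambda>\<omega>\<in>anchor_fibre \<Omega> (grng G g). v (lact \<Omega> (ginv G g) \<omega>))"
  by (simp_all add: Ind_def section_algebra_def sup_cmod_def)

lemma bundle_tube_Ind_C0:
  "(x, v) \<in> bundle_tube (Ind G H \<Omega> (C0_algebra H)) a U \<epsilon> \<longleftrightarrow>
    x \<in> U \<and> v \<in> (\<lambda>\<xi>. restrict \<xi> (anchor_fibre \<Omega> x)) ` Ind_sections H \<Omega> (C0_algebra H) \<and>
    sup_cmod (anchor_fibre \<Omega> x) (\<lambda>l. v l - a l) < \<epsilon>"
proof -
  have "sup_cmod (anchor_fibre \<Omega> x) (\<lambda>l\<in>anchor_fibre \<Omega> x.
      v l + (\<lambda>l\<in>anchor_fibre \<Omega> x. -1 * restrict a (anchor_fibre \<Omega> x) l) l)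
    = sup_cmod (anchor_fibre \<Omega> x) (\<lambda>l. v l - a l)"
    by (rule sup_cmod_cong) simp
  then show ?thesis
    unfolding bundle_tube_def Ind_C0_simps(1-3)
    by (simp add: Ind_def section_algebra_def)
qed

lemma vanishes_at_infinity_corr_quotientI:
  assumes "\<And>\<epsilon>. \<epsilon> > 0 \<Longrightarrow> \<exists>C. compactin (corr_quotient H \<Omega>) C \<and>
    (\<forall>\<omega>\<in>topspace (ctop \<Omega>). corr_class H \<Omega> \<omega> \<notin> C \<longrightarrow> \<bar>f (corr_class H \<Omega> \<omega>)\<bar> < \<epsilon>)"
  shows "vanishes_at_infinity (corr_quotient H \<Omega>) f"
  unfolding vanishes_at_infinity_def
proof (intro allI impI)
  fix \<epsilon> :: real assume "\<epsilon> > 0"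
  then obtain C where "compactin (corr_quotient H \<Omega>) C"
    "\<And>\<omega>. \<lbrakk>\<omega>\<in>topspace (ctop \<Omega>); corr_class H \<Omega> \<omega> \<notin> C\<rbrakk> \<Longrightarrow> \<bar>f (corr_class H \<Omega> \<omega>)\<bar> < \<epsilon>"
    using assms by meson
  moreover have "topspace (corr_quotient H \<Omega>) = corr_class H \<Omega> ` topspace (ctop \<Omega>)"
    by (simp add: corr_quotient_def orbit_space_def corr_class_def)
  ultimately show "\<exists>C. compactin (corr_quotient H \<Omega>) C
      \<and> (\<forall>x\<in>topspace (corr_quotient H \<Omega>) - C. \<bar>f x\<bar> < \<epsilon>)"
    by (intro exI[of _ C]) auto
qed

context etale_correspondence
begin

text \<open>The action of an arrow precomposes with a bijection between fibres, hence is isometric. In particular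
the norm of an equivariant section is constant on orbits.\<close>

lemma sup_cmod_fibre_act:
  assumes "g \<in> arrows G"
  shows "sup_cmod (anchor_fibre \<Omega> (grng G g)) (fibre_act (Ind G H \<Omega> (C0_algebra H)) g v)
    = sup_cmod (anchor_fibre \<Omega> (gsrc G g)) v"
proof -
  have "anchor_fibre \<Omega> (gsrc G g) = lact \<Omega> (ginv G g) ` anchor_fibre \<Omega> (grng G g)"
    using lact_anchor_fibre[OF G.inv_closed[OF assms]] assms by (simp add: G.src_inv G.rng_inv)
  then have "sup_cmod (anchor_fibre \<Omega> (gsrc G g)) v
      = sup_cmod (anchor_fibre \<Omega> (grng G g)) (\<lambda>\<omega>. v (lact \<Omega> (ginv G g) \<omega>))"
    by (simp add: sup_cmod_def image_image)
  also have "\<dots> = sup_cmod (anchor_fibre \<Omega> (grng G g)) (fibre_act (Ind G H \<Omega> (C0_algebra H)) g v)"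
    by (rule sup_cmod_cong) (simp add: Ind_C0_simps)
  finally show ?thesis by simp
qed

lemmas Ind_sections_C0 = Ind_sections_C0_iff[OF H.etale_groupoid_axioms right.continuous_anchor]

lemma anchor_pullback_apply:
  assumes "f \<in> C0_functions (unit_space G)" "\<omega> \<in> topspace (ctop \<Omega>)"
  shows "anchor_pullback G \<Omega> f \<omega> = f (lanchor \<Omega> \<omega>)"
  using assms by (simp add: anchor_pullback_def)

text \<open>The points of \<open>\<Omega>/H\<close> at which \<open>f \<circ> \<rho>\<close> is not small lie over a compact set of units of \<open>G\<close>, so they
are contained in a compact set by properness.\<close>

lemma anchor_pullback_in_Ind:
  assumes proper: "proper_correspondence G H \<Omega>" and f: "f \<in> C0_functions (unit_space G)"
  shows "anchor_pullback G \<Omega> f \<in> Ind_sections H \<Omega> (C0_algebra H)"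
  unfolding Ind_sections_C0
proof (intro conjI ballI impI)
  show "anchor_pullback G \<Omega> f \<in> extensional (topspace (ctop \<Omega>))"
    using f by (simp add: anchor_pullback_def)
  have "continuous_map (ctop \<Omega>) euclidean (f \<circ> lanchor \<Omega>)"
    by (rule continuous_map_compose[OF left.continuous_anchor C0_functions_continuous[OF f]])
  then show "continuous_map (ctop \<Omega>) euclidean (anchor_pullback G \<Omega> f)"
    by (rule continuous_map_eq) (simp add: anchor_pullback_apply f)
  obtain B where "\<forall>x\<in>topspace (unit_space G). cmod (f x) \<le> B"
    using C0_functions_bounded[OF f] by blast
  then show "\<exists>B. \<forall>\<omega>\<in>topspace (ctop \<Omega>). cmod (anchor_pullback G \<Omega> f \<omega>) \<le> B"
    unfolding G.topspace_unit_space
    by (intro exI[of _ B]) (simp add: anchor_pullback_apply f lanchor_unit)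
  show inv: "anchor_pullback G \<Omega> f (ract \<Omega> \<omega> h) = anchor_pullback G \<Omega> f \<omega>"
    if "\<omega> \<in> topspace (ctop \<Omega>)" "h \<in> arrows H" "grng H h = ranchor \<Omega> \<omega>" for \<omega> h
    using that by (simp add: anchor_pullback_apply f right_orbits.act_closed lanchor_ract)
  show "vanishes_at_infinity (corr_quotient H \<Omega>) (lift_class (\<lambda>\<omega>. cmod (anchor_pullback G \<Omega> f \<omega>)))"
  proof (rule vanishes_at_infinity_corr_quotientI)
    fix \<epsilon> :: real assume "\<epsilon> > 0"
    then obtain C where C: "compactin (unit_space G) C"
      "\<And>x. \<lbrakk>x \<in> topspace (unit_space G); x \<notin> C\<rbrakk> \<Longrightarrow> cmod (f x) < \<epsilon>"
      using f unfolding C0_functions_def vanishes_at_infinity_def by fastforce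
    let ?C = "{right_orbits.orbit x |x. x \<in> topspace (ctop \<Omega>) \<and> lanchor \<Omega> x \<in> C}"
    have "\<bar>lift_class (\<lambda>\<omega>. cmod (anchor_pullback G \<Omega> f \<omega>)) (right_orbits.orbit \<omega>)\<bar> < \<epsilon>"
      if \<omega>: "\<omega> \<in> topspace (ctop \<Omega>)" "right_orbits.orbit \<omega> \<notin> ?C" for \<omega>
    proof -
      have "lift_class (\<lambda>\<omega>. cmod (anchor_pullback G \<Omega> f \<omega>)) (right_orbits.orbit \<omega>)
          = cmod (anchor_pullback G \<Omega> f \<omega>)"
        using \<omega>(1) by (rule right_orbits.lift_class_orbit) (simp add: inv \<omega>(1))
      moreover have "lanchor \<Omega> \<omega> \<notin> C" using \<omega> by blast
      ultimately show ?thesis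
        using C(2)[of "lanchor \<Omega> \<omega>"] \<omega>(1) lanchor_unit[OF \<omega>(1)]
        by (simp add: anchor_pullback_apply f G.topspace_unit_space del: topspace_subtopology)
    qed
    then show "\<exists>C. compactin (corr_quotient H \<Omega>) C \<and> (\<forall>\<omega>\<in>topspace (ctop \<Omega>). corr_class H \<Omega> \<omega> \<notin> C \<longrightarrow>
        \<bar>lift_class (\<lambda>\<omega>. cmod (anchor_pullback G \<Omega> f \<omega>)) (corr_class H \<Omega> \<omega>)\<bar> < \<epsilon>)"
      using compactin_lanchor_preimage[OF proper C(1)] unfolding corr_class_def by blast
  qed
qed

lemma restrict_anchor_pullback:
  assumes "a \<in> C0_functions (unit_space G)"
  shows "restrict (anchor_pullback G \<Omega> a) (anchor_fibre \<Omega> x) = (\<lambda>\<omega>\<in>anchor_fibre \<Omega> x. a x)"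
  using assms by (auto simp: anchor_fibre_def anchor_pullback_apply)

text \<open>The definite description in \<open>fibre_map\<close> has a value because \<open>v\<close> is attained at \<open>x\<close> by some \<open>a\<close>, and
this value is unique since the restriction of the pullback of \<open>a\<close> to the fibre depends on \<open>a x\<close> only.\<close>

lemma fibre_map_anchor_pullback:
  assumes "x \<in> gunits G"
  shows "fibre_map (C0_algebra G) (Ind G H \<Omega> (C0_algebra H)) (anchor_pullback G \<Omega>) x v
    = (\<lambda>\<omega>\<in>anchor_fibre \<Omega> x. v)"
proof -
  obtain a where a: "a \<in> C0_functions (unit_space G)" "a x = v"
    using C0_functions_attain_value[OF G.locally_compact_units G.Hausdorff_units] assms
    unfolding G.topspace_unit_space by metis
  show ?thesis
    unfolding fibre_map_def Ind_C0_simps C0_algebra_simps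
  proof (rule the_equality)
    show "\<exists>a'\<in>C0_functions (unit_space G). a' x = v \<and>
        (\<lambda>\<omega>\<in>anchor_fibre \<Omega> x. v) = restrict (anchor_pullback G \<Omega> a') (anchor_fibre \<Omega> x)"
      using a by (intro bexI[of _ a]) (simp_all add: restrict_anchor_pullback)
  qed (auto simp: restrict_anchor_pullback)
qed

text \<open>The points at which \<open>c - a\<close> has modulus at least \<open>\<delta>\<close> form a saturated closed set, for a number \<open>\<delta>\<close>
between the norm at \<open>x0\<close> and \<open>\<epsilon>\<close>. The image of this set in the unit space is closed and misses \<open>x0\<close>.\<close>

lemma fibre_norm_upper_semicontinuous:
  assumes proper: "proper_correspondence G H \<Omega>" and a: "a \<in> Ind_sections H \<Omega> (C0_algebra H)"
    and x0: "x0 \<in> gunits G" and less: "sup_cmod (anchor_fibre \<Omega> x0) (\<lambda>\<omega>. c - a \<omega>) < \<epsilon>"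
  shows "\<exists>W. openin (unit_space G) W \<and> x0 \<in> W \<and>
    (\<forall>x\<in>W. sup_cmod (anchor_fibre \<Omega> x) (\<lambda>\<omega>. c - a \<omega>) < \<epsilon>)"
proof -
  note a' = a[unfolded Ind_sections_C0]
  obtain \<delta> where \<delta>: "sup_cmod (anchor_fibre \<Omega> x0) (\<lambda>\<omega>. c - a \<omega>) < \<delta>" "\<delta> < \<epsilon>"
    using less dense by blast
  obtain B where B: "\<And>\<omega>. \<omega> \<in> topspace (ctop \<Omega>) \<Longrightarrow> cmod (a \<omega>) \<le> B" using a' by blast
  have bound: "cmod (c - a \<omega>) \<le> cmod c + B" if "\<omega> \<in> anchor_fibre \<Omega> x" for \<omega> x
    using B[of \<omega>] that norm_triangle_ineq4[of c "a \<omega>"] by (simp add: anchor_fibre_def)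
  let ?D = "{\<omega> \<in> topspace (ctop \<Omega>). cmod (c - a \<omega>) \<in> {\<delta>..}}"
  have "continuous_map (ctop \<Omega>) euclideanreal (\<lambda>\<omega>. cmod (c - a \<omega>))"
    using a' by (intro continuous_map_norm continuous_map_diff) auto
  then have "closedin (ctop \<Omega>) ?D" by (rule closedin_continuous_map_preimage) simp
  then have "closedin (unit_space G) (lanchor \<Omega> ` ?D)"
  proof (rule closedin_lanchor_image[OF proper])
    fix x h assume "x \<in> topspace (ctop \<Omega>)" "h \<in> arrows H" "ranchor \<Omega> x = grng H h" "ract \<Omega> x h \<in> ?D"
    then show "x \<in> ?D" using a' by auto
  qed
  then have "openin (unit_space G) (topspace (unit_space G) - lanchor \<Omega> ` ?D)"
    by (simp add: openin_diff del: topspace_subtopology)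
  moreover have "x0 \<notin> lanchor \<Omega> ` ?D"
  proof
    assume "x0 \<in> lanchor \<Omega> ` ?D"
    then obtain \<omega> where \<omega>: "\<omega> \<in> anchor_fibre \<Omega> x0" "\<delta> \<le> cmod (c - a \<omega>)"
      by (auto simp: anchor_fibre_def)
    have "cmod (c - a \<omega>) \<le> sup_cmod (anchor_fibre \<Omega> x0) (\<lambda>\<omega>. c - a \<omega>)"
      using bound \<omega>(1) by (rule sup_cmod_upper)
    then show False using \<delta>(1) \<omega>(2) by simp
  qed
  moreover have "sup_cmod (anchor_fibre \<Omega> x) (\<lambda>\<omega>. c - a \<omega>) < \<epsilon>"
    if "x \<in> topspace (unit_space G) - lanchor \<Omega> ` ?D" for x
  proof -
    have "cmod (c - a \<omega>) \<le> \<delta>" if "\<omega> \<in> anchor_fibre \<Omega> x" for \<omega>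
      using that \<open>x \<in> topspace (unit_space G) - lanchor \<Omega> ` ?D\<close>
      by (force simp: anchor_fibre_def)
    moreover have "0 \<le> \<delta>"
      using sup_cmod_nonneg[of "anchor_fibre \<Omega> x0" "\<lambda>\<omega>. c - a \<omega>", OF bound] \<delta>(1) by fastforce
    ultimately have "sup_cmod (anchor_fibre \<Omega> x) (\<lambda>\<omega>. c - a \<omega>) \<le> \<delta>"
      by (intro sup_cmod_least) 
    then show ?thesis using \<delta>(2) by simp
  qed
  moreover have "x0 \<in> topspace (unit_space G)" using x0 unfolding G.topspace_unit_space .
  ultimately show ?thesis
    by (intro exI[of _ "topspace (unit_space G) - lanchor \<Omega> ` ?D"] conjI ballI DiffI)
qed

end

section \<open>The map induced by the anchor pullback\<close>

locale composable_correspondences =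
  Om: etale_correspondence G H \<Omega> + La: etale_correspondence H K \<Lambda>
  for G :: "'g groupoid" and H :: "'h groupoid" and K :: "'k groupoid"
    and \<Omega> :: "('o, 'g, 'h) correspondence" and \<Lambda> :: "('l, 'h, 'k) correspondence"
begin

abbreviation Ind_\<Lambda> :: "('h, 'l \<Rightarrow> complex, 'l \<Rightarrow> complex) gpd_algebra" where
  "Ind_\<Lambda> \<equiv> Ind H K \<Lambda> (C0_algebra K)"

lemma lift_class_fibre_norm:
  assumes "\<And>\<omega> h. \<lbrakk>\<omega> \<in> topspace (ctop \<Omega>); h \<in> arrows H; grng H h = ranchor \<Omega> \<omega>\<rbrakk>
      \<Longrightarrow> \<xi> (ract \<Omega> \<omega> h) = fibre_act Ind_\<Lambda> (ginv H h) (\<xi> \<omega>)"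
    and \<omega>: "\<omega> \<in> topspace (ctop \<Omega>)"
  shows "lift_class (\<lambda>\<omega>. alg_norm (fibre Ind_\<Lambda> (ranchor \<Omega> \<omega>)) (\<xi> \<omega>)) (Om.right_orbits.orbit \<omega>)
    = sup_cmod (anchor_fibre \<Lambda> (ranchor \<Omega> \<omega>)) (\<xi> \<omega>)"
  unfolding Ind_C0_simps(3)
proof (rule Om.right_orbits.lift_class_orbit[OF \<omega>])
  fix h assume h: "h \<in> arrows H" "ranchor \<Omega> \<omega> = grng H h"
  show "sup_cmod (anchor_fibre \<Lambda> (ranchor \<Omega> (ract \<Omega> \<omega> h))) (\<xi> (ract \<Omega> \<omega> h))
      = sup_cmod (anchor_fibre \<Lambda> (ranchor \<Omega> \<omega>)) (\<xi> \<omega>)"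
    using La.sup_cmod_fibre_act[OF Om.H.inv_closed[OF h(1)], of "\<xi> \<omega>"] assms(1)[OF \<omega> h(1)] h \<omega>
    by (simp add: Om.right_orbits.anchor_act Om.H.rng_inv Om.H.src_inv)
qed

text \<open>The explicit form of the image of \<open>\<xi>\<close> under the map induced by the anchor pullback of \<open>\<Lambda>\<close>.\<close>

definition fibrewise_constant :: "('o \<Rightarrow> complex) \<Rightarrow> ('o \<Rightarrow> 'l \<Rightarrow> complex)" where
  "fibrewise_constant \<xi> = (\<lambda>\<omega>\<in>topspace (ctop \<Omega>). \<lambda>l\<in>anchor_fibre \<Lambda> (ranchor \<Omega> \<omega>). \<xi> \<omega>)"

lemma Ind_map_anchor_pullback:
  assumes "\<xi> \<in> Ind_sections H \<Omega> (C0_algebra H)"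
  shows "Ind_map G H \<Omega> (C0_algebra H) Ind_\<Lambda> (anchor_pullback H \<Lambda>) \<xi> = fibrewise_constant \<xi>"
  using assms unfolding Ind_map_def fibrewise_constant_def alg_set_Ind
  by (auto simp: La.fibre_map_anchor_pullback Om.right_orbits.anchor_unit intro!: restrict_ext)

lemma fibrewise_constant_in_fibre:
  assumes proper: "proper_correspondence H K \<Lambda>" and \<omega>: "\<omega> \<in> topspace (ctop \<Omega>)"
  shows "fibrewise_constant \<xi> \<omega> \<in> (\<lambda>a. restrict a (anchor_fibre \<Lambda> (ranchor \<Omega> \<omega>))) `
      Ind_sections K \<Lambda> (C0_algebra K)"
proof -
  have "ranchor \<Omega> \<omega> \<in> topspace (unit_space H)"
    unfolding Om.H.topspace_unit_space using \<omega> by (rule Om.right_orbits.anchor_unit)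
  from C0_functions_attain_value[OF Om.H.locally_compact_units Om.H.Hausdorff_units this]
  obtain a where a: "a \<in> C0_functions (unit_space H)" "a (ranchor \<Omega> \<omega>) = \<xi> \<omega>" by blast
  then have "fibrewise_constant \<xi> \<omega>
      = restrict (anchor_pullback H \<Lambda> a) (anchor_fibre \<Lambda> (ranchor \<Omega> \<omega>))"
    using \<omega> by (simp add: La.restrict_anchor_pullback fibrewise_constant_def)
  then show ?thesis using La.anchor_pullback_in_Ind[OF proper a(1)] by blast
qed

text \<open>Near a given point, both the change of the scalar \<open>\<xi> \<omega>\<close> and, by upper semicontinuity, the norm of
\<open>\<xi> \<omega>0 - a\<close> on the nearby fibres are controlled.\<close>

lemma continuous_map_fibrewise_constant:
  assumes proper: "proper_correspondence H K \<Lambda>" and \<xi>: "continuous_map (ctop \<Omega>) euclidean \<xi>"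
  shows "continuous_map (ctop \<Omega>) (bundle_topology H Ind_\<Lambda>) (\<lambda>\<omega>. (ranchor \<Omega> \<omega>, fibrewise_constant \<xi> \<omega>))"
  unfolding continuous_map_bundle_iff bundle_tube_Ind_C0 alg_set_Ind
proof (intro conjI ballI allI impI)
  fix \<omega> assume \<omega>: "\<omega> \<in> topspace (ctop \<Omega>)"
  obtain a where a: "a \<in> Ind_sections K \<Lambda> (C0_algebra K)"
    "fibrewise_constant \<xi> \<omega> = restrict a (anchor_fibre \<Lambda> (ranchor \<Omega> \<omega>))"
    using fibrewise_constant_in_fibre[OF proper \<omega>] by blast
  have "sup_cmod (anchor_fibre \<Lambda> (ranchor \<Omega> \<omega>)) (\<lambda>l. fibrewise_constant \<xi> \<omega> l - a l) \<le> 0"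
    by (rule sup_cmod_least) (simp_all add: a(2))
  moreover have "ranchor \<Omega> \<omega> \<in> topspace (unit_space H)"
    unfolding Om.H.topspace_unit_space using \<omega> by (rule Om.right_orbits.anchor_unit)
  ultimately show "\<exists>a U \<epsilon>. a \<in> Ind_sections K \<Lambda> (C0_algebra K) \<and> openin (unit_space H) U \<and> 0 < \<epsilon> \<and>
      ranchor \<Omega> \<omega> \<in> U \<and> fibrewise_constant \<xi> \<omega> \<in> (\<lambda>a. restrict a (anchor_fibre \<Lambda> (ranchor \<Omega> \<omega>))) `
        Ind_sections K \<Lambda> (C0_algebra K) \<and>
      sup_cmod (anchor_fibre \<Lambda> (ranchor \<Omega> \<omega>)) (\<lambda>l. fibrewise_constant \<xi> \<omega> l - a l) < \<epsilon>"
    using a(1) fibrewise_constant_in_fibre[OF proper \<omega>]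
    by (intro exI[of _ a] exI[of _ "topspace (unit_space H)"] exI[of _ "1 :: real"])
       (simp del: topspace_subtopology)
next
  fix a U and \<epsilon> :: real
  assume asm: "a \<in> Ind_sections K \<Lambda> (C0_algebra K) \<and> openin (unit_space H) U \<and> 0 < \<epsilon>"
  then have a: "a \<in> Ind_sections K \<Lambda> (C0_algebra K)" and U: "openin (unit_space H) U" by auto
  let ?dist = "\<lambda>x c. sup_cmod (anchor_fibre \<Lambda> x) (\<lambda>l. c - a l)"
  define S where "S = {\<omega> \<in> topspace (ctop \<Omega>). ranchor \<Omega> \<omega> \<in> U \<and> ?dist (ranchor \<Omega> \<omega>) (\<xi> \<omega>) < \<epsilon>}"
  obtain B where B: "\<And>l. l \<in> topspace (ctop \<Lambda>) \<Longrightarrow> cmod (a l) \<le> B"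
    using a[unfolded La.Ind_sections_C0] by blast
  have bound: "cmod (c - a l) \<le> cmod c + B" if "l \<in> anchor_fibre \<Lambda> x" for c l x
    using B[of l] that norm_triangle_ineq4[of c "a l"] by (simp add: anchor_fibre_def)
  have "\<exists>T. openin (ctop \<Omega>) T \<and> \<omega>0 \<in> T \<and> T \<subseteq> S" if "\<omega>0 \<in> S" for \<omega>0
  proof -
    have \<omega>0: "\<omega>0 \<in> topspace (ctop \<Omega>)" "ranchor \<Omega> \<omega>0 \<in> U" "?dist (ranchor \<Omega> \<omega>0) (\<xi> \<omega>0) < \<epsilon>"
      using that by (simp_all add: S_def)
    then obtain \<delta> where \<delta>: "?dist (ranchor \<Omega> \<omega>0) (\<xi> \<omega>0) < \<delta>" "\<delta> < \<epsilon>" using dense by blast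
    obtain W where W: "openin (unit_space H) W" "ranchor \<Omega> \<omega>0 \<in> W"
      and dist_W: "\<forall>x\<in>W. ?dist x (\<xi> \<omega>0) < \<delta>"
      using La.fibre_norm_upper_semicontinuous[OF proper a
          Om.right_orbits.anchor_unit[OF \<omega>0(1)] \<delta>(1)] by blast
    \<comment> \<open>The margin \<open>\<epsilon> - \<delta>\<close> is left for the variation of the scalar.\<close>
    have "0 < \<epsilon> - \<delta>" using \<delta> by simp
    from \<xi>[unfolded continuous_map_complex_iff, rule_format, OF \<omega>0(1) this]
    obtain V where V: "openin (ctop \<Omega>) V" "\<omega>0 \<in> V" "\<And>\<omega>. \<omega> \<in> V \<Longrightarrow> cmod (\<xi> \<omega> - \<xi> \<omega>0) < \<epsilon> - \<delta>"
      by auto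
    let ?T = "V \<inter> {\<omega> \<in> topspace (ctop \<Omega>). ranchor \<Omega> \<omega> \<in> W \<inter> U}"
    have "openin (ctop \<Omega>) ?T"
      using V(1) W(1) U
      by (intro openin_Int openin_continuous_map_preimage[OF Om.right.continuous_anchor]) auto
    moreover have "\<omega>0 \<in> ?T" using V(2) W(2) \<omega>0 by simp
    moreover have "\<omega> \<in> S" if \<omega>: "\<omega> \<in> ?T" for \<omega>
    proof -
      let ?x = "ranchor \<Omega> \<omega>"
      have "cmod (\<xi> \<omega> - a l) \<le> cmod (\<xi> \<omega> - \<xi> \<omega>0) + ?dist ?x (\<xi> \<omega>0)" if l: "l \<in> anchor_fibre \<Lambda> ?x" for l
      proof -
        have "cmod (\<xi> \<omega>0 - a l) \<le> ?dist ?x (\<xi> \<omega>0)" using bound l by (rule sup_cmod_upper)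
        then show ?thesis using norm_triangle_ineq[of "\<xi> \<omega> - \<xi> \<omega>0" "\<xi> \<omega>0 - a l"] by simp
      qed
      moreover have "0 \<le> ?dist ?x (\<xi> \<omega>0)" using bound by (rule sup_cmod_nonneg)
      ultimately have "?dist ?x (\<xi> \<omega>) \<le> cmod (\<xi> \<omega> - \<xi> \<omega>0) + ?dist ?x (\<xi> \<omega>0)"
        by (intro sup_cmod_least) simp_all
      also have "\<dots> < \<epsilon>" using V(3)[of \<omega>] bspec[OF dist_W, of ?x] \<omega> by simp
      finally show ?thesis using \<omega> by (simp add: S_def)
    qed
    ultimately show ?thesis by (intro exI[of _ ?T]) auto
  qed
  then have "openin (ctop \<Omega>) S" by (subst openin_subopen) simp
  moreover have "{\<omega> \<in> topspace (ctop \<Omega>). ranchor \<Omega> \<omega> \<in> U \<and>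
      fibrewise_constant \<xi> \<omega> \<in> (\<lambda>a. restrict a (anchor_fibre \<Lambda> (ranchor \<Omega> \<omega>))) `
        Ind_sections K \<Lambda> (C0_algebra K) \<and>
      sup_cmod (anchor_fibre \<Lambda> (ranchor \<Omega> \<omega>)) (\<lambda>l. fibrewise_constant \<xi> \<omega> l - a l) < \<epsilon>} = S"
  proof -
    have "sup_cmod (anchor_fibre \<Lambda> (ranchor \<Omega> \<omega>)) (\<lambda>l. fibrewise_constant \<xi> \<omega> l - a l)
        = ?dist (ranchor \<Omega> \<omega>) (\<xi> \<omega>)" if "\<omega> \<in> topspace (ctop \<Omega>)" for \<omega>
      using that by (intro sup_cmod_cong) (simp add: fibrewise_constant_def)
    then show ?thesis
      unfolding S_def by (simp add: fibrewise_constant_in_fibre[OF proper] cong: conj_cong)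
  qed
  ultimately show "openin (ctop \<Omega>) {\<omega> \<in> topspace (ctop \<Omega>). ranchor \<Omega> \<omega> \<in> U \<and>
      fibrewise_constant \<xi> \<omega> \<in> (\<lambda>a. restrict a (anchor_fibre \<Lambda> (ranchor \<Omega> \<omega>))) `
        Ind_sections K \<Lambda> (C0_algebra K) \<and>
      sup_cmod (anchor_fibre \<Lambda> (ranchor \<Omega> \<omega>)) (\<lambda>l. fibrewise_constant \<xi> \<omega> l - a l) < \<epsilon>}"
    by simp
qed

text \<open>The norm of the constant \<open>\<xi> \<omega>\<close> on a fibre is at most \<open>\<bar>\<xi> \<omega>\<bar>\<close> (and \<open>0\<close> if the fibre is empty), so
boundedness and vanishing at infinity pass over from \<open>\<xi>\<close>.\<close>

lemma fibrewise_constant_in_Ind: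
  assumes proper: "proper_correspondence H K \<Lambda>" and \<xi>: "\<xi> \<in> Ind_sections H \<Omega> (C0_algebra H)"
  shows "fibrewise_constant \<xi> \<in> Ind_sections H \<Omega> Ind_\<Lambda>"
proof -
  note \<xi>' = \<xi>[unfolded Om.Ind_sections_C0]
  have inv: "\<xi> (ract \<Omega> \<omega> h) = \<xi> \<omega>"
    if "\<omega> \<in> topspace (ctop \<Omega>)" "h \<in> arrows H" "grng H h = ranchor \<Omega> \<omega>" for \<omega> h
    using \<xi>' that by blast
  have norm: "sup_cmod (anchor_fibre \<Lambda> (ranchor \<Omega> \<omega>)) (fibrewise_constant \<xi> \<omega>) \<le> cmod (\<xi> \<omega>)"
    if "\<omega> \<in> topspace (ctop \<Omega>)" for \<omega>
    using that by (intro sup_cmod_least) (simp_all add: fibrewise_constant_def)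
  have norm_nonneg: "0 \<le> sup_cmod (anchor_fibre \<Lambda> (ranchor \<Omega> \<omega>)) (fibrewise_constant \<xi> \<omega>)"
    if "\<omega> \<in> topspace (ctop \<Omega>)" for \<omega>
    using that by (intro sup_cmod_nonneg[of _ _ "cmod (\<xi> \<omega>)"]) (simp add: fibrewise_constant_def)
  have equi: "fibrewise_constant \<xi> (ract \<Omega> \<omega> h) = fibre_act Ind_\<Lambda> (ginv H h) (fibrewise_constant \<xi> \<omega>)"
    if \<omega>: "\<omega> \<in> topspace (ctop \<Omega>)" and h: "h \<in> arrows H" "grng H h = ranchor \<Omega> \<omega>" for \<omega> h
  proof -
    have "lact \<Lambda> h l \<in> anchor_fibre \<Lambda> (ranchor \<Omega> \<omega>)" if "l \<in> anchor_fibre \<Lambda> (gsrc H h)" for l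
      using La.lact_anchor_fibre[OF h(1)] h(2) that by auto
    moreover have "\<xi> (ract \<Omega> \<omega> h) = \<xi> \<omega>" using \<omega> h by (rule inv)
    ultimately show ?thesis
      unfolding fibrewise_constant_def Ind_C0_simps using \<omega> h
      by (auto simp: Om.right_orbits.anchor_act Om.right_orbits.act_closed Om.H.rng_inv Om.H.inv_inv
          intro!: restrict_ext)
  qed
  show ?thesis
    unfolding Ind_sections_def mem_Collect_eq
  proof (intro conjI ballI impI)
    show "fibrewise_constant \<xi> \<in> extensional (topspace (ctop \<Omega>))" by (simp add: fibrewise_constant_def)
    show "continuous_map (ctop \<Omega>) (bundle_topology H Ind_\<Lambda>) (\<lambda>\<omega>. (ranchor \<Omega> \<omega>, fibrewise_constant \<xi> \<omega>))"
      by (rule continuous_map_fibrewise_constant[OF proper]) (use \<xi>' in blast)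
    obtain B where B: "\<forall>\<omega>\<in>topspace (ctop \<Omega>). cmod (\<xi> \<omega>) \<le> B" using \<xi>' by blast
    show "\<exists>B. \<forall>\<omega>\<in>topspace (ctop \<Omega>). alg_norm (fibre Ind_\<Lambda> (ranchor \<Omega> \<omega>)) (fibrewise_constant \<xi> \<omega>) \<le> B"
      unfolding Ind_C0_simps by (intro exI[of _ B] ballI order_trans[OF norm] bspec[OF B])
    show "vanishes_at_infinity (corr_quotient H \<Omega>)
        (lift_class (\<lambda>\<omega>. alg_norm (fibre Ind_\<Lambda> (ranchor \<Omega> \<omega>)) (fibrewise_constant \<xi> \<omega>)))"
    proof (rule vanishes_at_infinity_corr_quotientI)
      fix \<epsilon> :: real assume "\<epsilon> > 0"
      then obtain C where C: "compactin (corr_quotient H \<Omega>) C"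
        "\<forall>z\<in>topspace (corr_quotient H \<Omega>) - C. \<bar>lift_class (\<lambda>\<omega>. cmod (\<xi> \<omega>)) z\<bar> < \<epsilon>"
        using \<xi>' unfolding vanishes_at_infinity_def by blast
      have "\<bar>lift_class (\<lambda>\<omega>. alg_norm (fibre Ind_\<Lambda> (ranchor \<Omega> \<omega>)) (fibrewise_constant \<xi> \<omega>))
            (Om.right_orbits.orbit \<omega>)\<bar> < \<epsilon>"
        if \<omega>: "\<omega> \<in> topspace (ctop \<Omega>)" "Om.right_orbits.orbit \<omega> \<notin> C" for \<omega>
      proof -
        have "lift_class (\<lambda>\<omega>. cmod (\<xi> \<omega>)) (Om.right_orbits.orbit \<omega>) = cmod (\<xi> \<omega>)"
          using \<omega>(1) by (rule Om.right_orbits.lift_class_orbit) (simp add: inv[OF \<omega>(1)])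
        moreover have "Om.right_orbits.orbit \<omega> \<in> topspace (corr_quotient H \<Omega>) - C"
          using \<omega> by (simp add: Om.topspace_corr_quotient)
        ultimately have "cmod (\<xi> \<omega>) < \<epsilon>"
          using bspec[OF C(2), of "Om.right_orbits.orbit \<omega>"] by simp
        moreover have "lift_class (\<lambda>\<omega>. alg_norm (fibre Ind_\<Lambda> (ranchor \<Omega> \<omega>)) (fibrewise_constant \<xi> \<omega>))
            (Om.right_orbits.orbit \<omega>) = sup_cmod (anchor_fibre \<Lambda> (ranchor \<Omega> \<omega>)) (fibrewise_constant \<xi> \<omega>)"
          by (rule lift_class_fibre_norm[OF equi \<omega>(1)])
        ultimately show ?thesis using norm[OF \<omega>(1)] norm_nonneg[OF \<omega>(1)] by linarith
      qed
      then show "\<exists>C. compactin (corr_quotient H \<Omega>) C \<and>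
          (\<forall>\<omega>\<in>topspace (ctop \<Omega>). corr_class H \<Omega> \<omega> \<notin> C \<longrightarrow>
            \<bar>lift_class (\<lambda>\<omega>. alg_norm (fibre Ind_\<Lambda> (ranchor \<Omega> \<omega>)) (fibrewise_constant \<xi> \<omega>))
              (corr_class H \<Omega> \<omega>)\<bar> < \<epsilon>)"
        unfolding corr_class_def by (intro exI[of _ C] conjI ballI impI C(1))
    qed
  qed (rule equi)
qed

section \<open>The composition of two correspondences\<close>

abbreviation fibre_product :: "('o \<times> 'l) topology" where
  "fibre_product \<equiv> subtopology (prod_topology (ctop \<Omega>) (ctop \<Lambda>)) {(\<omega>, l). ranchor \<Omega> \<omega> = lanchor \<Lambda> l}"

abbreviation composite :: "(('o \<times> 'l) set, 'g, 'k) correspondence" where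
  "composite \<equiv> corr_comp H \<Lambda> \<Omega>"

lemma mem_fibre_product:
  "(\<omega>, l) \<in> topspace fibre_product \<longleftrightarrow>
    \<omega> \<in> topspace (ctop \<Omega>) \<and> l \<in> topspace (ctop \<Lambda>) \<and> ranchor \<Omega> \<omega> = lanchor \<Lambda> l"
  by auto

sublocale diagonal: orbit_action H "topspace fibre_product" "\<lambda>(\<omega>, l). ranchor \<Omega> \<omega>"
  "\<lambda>(\<omega>, l) h. (ract \<Omega> \<omega> h, lact \<Lambda> (ginv H h) l)"
proof (unfold_locales, unfold split_paired_all mem_fibre_product prod.case, goal_cases)
  case (1 \<omega> l h)
  then show ?case
    by (simp add: Om.right_orbits.act_closed La.lact_closed Om.right_orbits.anchor_act
        La.left.anchor_act Om.H.inv_closed Om.H.src_inv Om.H.rng_inv)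
next
  case (2 \<omega> l)
  then show ?case using Om.right_orbits.anchor_unit[of \<omega>] by simp
next
  case (3 \<omega> l h)
  then show ?case by (simp add: Om.right_orbits.anchor_act)
next
  case (4 \<omega> l g h)
  then show ?case
    using La.left.act_mul[of "ginv H h" "ginv H g" l]
    by (simp add: Om.right_orbits.act_mul Om.H.inv_gmul Om.H.inv_closed Om.H.src_inv Om.H.rng_inv)
next
  case (5 \<omega> l)
  then show ?case
    by (simp add: Om.right_orbits.act_unit La.left.act_unit Om.H.inv_of_unit La.lanchor_unit)
       (metis Om.right_orbits.act_unit)
qed

lemma comp_class_eq: "comp_class H \<Lambda> \<Omega> = diagonal.orbit"
  by (simp add: comp_class_def)

lemma quotient_map_composite: "quotient_map fibre_product (ctop composite) diagonal.orbit"
  unfolding corr_comp_def orbit_space_def by (simp add: quotient_map_quotient_topology)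

lemma topspace_composite: "topspace (ctop composite) = diagonal.orbit ` topspace fibre_product"
  using quotient_imp_surjective_map[OF quotient_map_composite] by simp

lemma topspace_compositeE:
  assumes "z \<in> topspace (ctop composite)"
  obtains \<omega> l where "(\<omega>, l) \<in> topspace fibre_product" "z = diagonal.orbit (\<omega>, l)"
proof -
  obtain p where p: "z = diagonal.orbit p" "p \<in> topspace fibre_product"
    using assms unfolding topspace_composite by (rule imageE)
  obtain \<omega> l where "p = (\<omega>, l)" by (cases p)
  with p show thesis by (intro that[of \<omega> l]) (simp_all only:)
qed

lemma lift_class_composite:
  assumes "(\<omega>, l) \<in> topspace fibre_product"
    and "\<And>h. \<lbrakk>h \<in> arrows H; grng H h = ranchor \<Omega> \<omega>\<rbrakk>
      \<Longrightarrow> f (ract \<Omega> \<omega> h) (lact \<Lambda> (ginv H h) l) = f \<omega> l"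
  shows "lift_class (\<lambda>(\<omega>, l). f \<omega> l) (diagonal.orbit (\<omega>, l)) = f \<omega> l"
  using diagonal.lift_class_orbit[OF assms(1), of "\<lambda>(\<omega>, l). f \<omega> l"] assms(2) by simp

lemma lanchor_composite:
  assumes "(\<omega>, l) \<in> topspace fibre_product"
  shows "lanchor composite (diagonal.orbit (\<omega>, l)) = lanchor \<Omega> \<omega>"
  unfolding corr_comp_def correspondence.simps
  using assms by (intro lift_class_composite) (simp_all add: Om.lanchor_ract)

lemma ranchor_composite:
  assumes "(\<omega>, l) \<in> topspace fibre_product"
  shows "ranchor composite (diagonal.orbit (\<omega>, l)) = ranchor \<Lambda> l"
  unfolding corr_comp_def correspondence.simps
  using assms by (intro lift_class_composite)
    (auto simp: La.ranchor_lact Om.H.inv_closed Om.H.src_inv)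

text \<open>Acting by \<open>k\<close> on the second component respects the diagonal orbits because the two actions on \<open>\<Lambda>\<close> commute.\<close>

lemma ract_composite:
  assumes p: "(\<omega>, l) \<in> topspace fibre_product" and k: "k \<in> arrows K" "ranchor \<Lambda> l = grng K k"
  shows "ract composite (diagonal.orbit (\<omega>, l)) k = diagonal.orbit (\<omega>, ract \<Lambda> l k)"
proof -
  have "diagonal.orbit (ract \<Omega> \<omega> h, ract \<Lambda> (lact \<Lambda> (ginv H h) l) k) = diagonal.orbit (\<omega>, ract \<Lambda> l k)"
    if h: "h \<in> arrows H" "grng H h = ranchor \<Omega> \<omega>" for h
  proof -
    have "ract \<Lambda> (lact \<Lambda> (ginv H h) l) k = lact \<Lambda> (ginv H h) (ract \<Lambda> l k)"
      using p k h by (intro La.actions_commute) (auto simp: Om.H.inv_closed Om.H.src_inv)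
    moreover have "(\<omega>, ract \<Lambda> l k) \<in> topspace fibre_product"
      using p k by (simp add: La.lanchor_ract La.right_orbits.act_closed)
    ultimately show ?thesis
      using diagonal.orbit_act[of "(\<omega>, ract \<Lambda> l k)" h] h by simp
  qed
  then show ?thesis
    unfolding corr_comp_def correspondence.simps comp_class_eq using p
    by (intro lift_class_composite)
qed

lemma ract_fibre_product:
  assumes "(\<omega>, l) \<in> topspace fibre_product" "k \<in> arrows K" "ranchor \<Lambda> l = grng K k"
  shows "(\<omega>, ract \<Lambda> l k) \<in> topspace fibre_product"
  using assms by (simp add: La.lanchor_ract La.right_orbits.act_closed)

lemma continuous_ranchor_composite: "continuous_map (ctop composite) (unit_space K) (ranchor composite)"
proof (rule continuous_compose_quotient_map[OF quotient_map_composite])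
  have "continuous_map fibre_product (ctop \<Lambda>) snd"
    by (intro continuous_map_from_subtopology continuous_map_snd)
  from continuous_map_compose[OF this La.right.continuous_anchor]
  show "continuous_map fibre_product (unit_space K) (ranchor composite \<circ> diagonal.orbit)"
    by (rule continuous_map_eq) (use ranchor_composite in force)
qed

text \<open>The axioms are checked on representatives, where \<open>K\<close> acts on the second component only.\<close>

sublocale composite_orbits: orbit_action K "topspace (ctop composite)" "ranchor composite" "ract composite"
proof (unfold_locales, goal_cases)
  case (1 z h)
  obtain \<omega> l where p: "(\<omega>, l) \<in> topspace fibre_product" and z: "z = diagonal.orbit (\<omega>, l)"
    using 1(1) by (rule topspace_compositeE)
  have h: "h \<in> arrows K" "ranchor \<Lambda> l = grng K h" using 1(2,3) unfolding z ranchor_composite[OF p] .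
  show ?case
    unfolding z ract_composite[OF p h] topspace_composite using ract_fibre_product[OF p h] by (rule imageI)
next
  case (2 z)
  obtain \<omega> l where p: "(\<omega>, l) \<in> topspace fibre_product" and z: "z = diagonal.orbit (\<omega>, l)"
    using 2 by (rule topspace_compositeE)
  show ?case unfolding z ranchor_composite[OF p] using p by (simp add: La.right_orbits.anchor_unit)
next
  case (3 z h)
  obtain \<omega> l where p: "(\<omega>, l) \<in> topspace fibre_product" and z: "z = diagonal.orbit (\<omega>, l)"
    using 3(1) by (rule topspace_compositeE)
  have h: "h \<in> arrows K" "ranchor \<Lambda> l = grng K h" using 3(2,3) unfolding z ranchor_composite[OF p] .
  show ?case
    unfolding z ract_composite[OF p h] ranchor_composite[OF ract_fibre_product[OF p h]]
    using p h by (simp add: La.right_orbits.anchor_act)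
next
  case (4 z g h)
  obtain \<omega> l where p: "(\<omega>, l) \<in> topspace fibre_product" and z: "z = diagonal.orbit (\<omega>, l)"
    using 4(1) by (rule topspace_compositeE)
  have g: "g \<in> arrows K" "ranchor \<Lambda> l = grng K g" using 4(2,4) unfolding z ranchor_composite[OF p] .
  have l: "l \<in> topspace (ctop \<Lambda>)" using p by simp
  have gh: "gmul K g h \<in> arrows K" "ranchor \<Lambda> l = grng K (gmul K g h)"
    using 4(3,5) g by (simp_all add: La.H.mul_closed La.H.rng_mul)
  have h: "ranchor \<Lambda> (ract \<Lambda> l g) = grng K h"
    using 4(5) by (simp add: La.right_orbits.anchor_act[OF l g])
  show ?case
    unfolding z ract_composite[OF p gh] ract_composite[OF p g] ract_composite[OF ract_fibre_product[OF p g] 4(3) h]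
      La.right_orbits.act_mul[OF l g(1) 4(3) g(2) 4(5)] ..
next
  case (5 z)
  obtain \<omega> l where p: "(\<omega>, l) \<in> topspace fibre_product" and z: "z = diagonal.orbit (\<omega>, l)"
    using 5 by (rule topspace_compositeE)
  have l: "l \<in> topspace (ctop \<Lambda>)" using p by simp
  have k: "ranchor \<Lambda> l \<in> arrows K" "ranchor \<Lambda> l = grng K (ranchor \<Lambda> l)"
    using l by (simp_all add: La.right_orbits.anchor_arrow La.H.rng_of_unit La.right_orbits.anchor_unit)
  show ?case
    unfolding z ranchor_composite[OF p] ract_composite[OF p k] La.right_orbits.act_unit[OF l] ..
qed

text \<open>Choose compact sets of representatives, \<open>N\<close> in \<open>\<Omega>\<close> for \<open>C\<close> and \<open>M\<close> in \<open>\<Lambda>\<close> for the compact part of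
\<open>\<Lambda>/K\<close> lying over \<open>\<sigma>(N)\<close>. The pairs in \<open>N \<times> M\<close> with equal anchors form a compact set, as the
units of \<open>H\<close> are Hausdorff. Every class \<open>[\<omega>, l]\<close> over \<open>C\<close> comes from one of them: if \<open>\<omega> = n h\<close>,
then \<open>[\<omega>, l] = [n, h l]\<close>, and \<open>h l = m k\<close> for some \<open>m\<close> in \<open>M\<close>.\<close>

lemma compactin_composite_quotient_over:
  assumes proper: "proper_correspondence H K \<Lambda>" and C: "compactin (corr_quotient H \<Omega>) C"
  shows "\<exists>D. compactin (corr_quotient K composite) D \<and>
    (\<forall>\<omega> l. (\<omega>, l) \<in> topspace fibre_product \<and> Om.right_orbits.orbit \<omega> \<in> C \<longrightarrow>
      composite_orbits.orbit (diagonal.orbit (\<omega>, l)) \<in> D)"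
proof -
  obtain N where N: "compactin (ctop \<Omega>) N"
    and repN: "\<forall>\<omega>\<in>topspace (ctop \<Omega>). Om.right_orbits.orbit \<omega> \<in> C \<longrightarrow>
      (\<exists>n\<in>N. \<exists>h\<in>arrows H. ranchor \<Omega> n = grng H h \<and> \<omega> = ract \<Omega> n h)"
    using Om.compactin_orbit_representatives[OF C] by blast
  have "compactin (unit_space H) (ranchor \<Omega> ` N)"
    by (rule image_compactin[OF N Om.right.continuous_anchor])
  then have P: "compactin (corr_quotient K \<Lambda>)
      {La.right_orbits.orbit l |l. l \<in> topspace (ctop \<Lambda>) \<and> lanchor \<Lambda> l \<in> ranchor \<Omega> ` N}"
      (is "compactin _ ?P")
    by (rule La.compactin_lanchor_preimage[OF proper])
  obtain M where M: "compactin (ctop \<Lambda>) M"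
    and repM: "\<forall>l\<in>topspace (ctop \<Lambda>). La.right_orbits.orbit l \<in> ?P \<longrightarrow>
      (\<exists>m\<in>M. \<exists>k\<in>arrows K. ranchor \<Lambda> m = grng K k \<and> l = ract \<Lambda> m k)"
    using La.compactin_orbit_representatives[OF P] by blast
  let ?E = "{p \<in> topspace (prod_topology (ctop \<Omega>) (ctop \<Lambda>)).
      (ranchor \<Omega> \<circ> fst) p = (lanchor \<Lambda> \<circ> snd) p}"
  have "closedin (prod_topology (ctop \<Omega>) (ctop \<Lambda>)) ?E"
    by (rule closedin_continuous_maps_eq[OF Om.H.Hausdorff_units
          continuous_map_compose[OF continuous_map_fst Om.right.continuous_anchor]
          continuous_map_compose[OF continuous_map_snd La.left.continuous_anchor]])
  moreover have "compactin (prod_topology (ctop \<Omega>) (ctop \<Lambda>)) (N \<times> M)"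
    using N M by (simp add: compactin_Times)
  ultimately have "compactin (prod_topology (ctop \<Omega>) (ctop \<Lambda>)) (?E \<inter> (N \<times> M))"
    by (rule closed_Int_compactin)
  then have T: "compactin fibre_product (?E \<inter> (N \<times> M))"
    by (auto simp: compactin_subtopology)
  have qm: "quotient_map (ctop composite) (corr_quotient K composite) composite_orbits.orbit"
    unfolding corr_quotient_def orbit_space_def by (rule quotient_map_quotient_topology)
  let ?q = "composite_orbits.orbit \<circ> diagonal.orbit"
  have "continuous_map fibre_product (corr_quotient K composite) ?q"
    by (rule continuous_map_compose[OF quotient_imp_continuous_map[OF quotient_map_composite]
          quotient_imp_continuous_map[OF qm]])
  then have D: "compactin (corr_quotient K composite) (?q ` (?E \<inter> (N \<times> M)))"
    by (rule image_compactin[OF T])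
  show ?thesis
  proof (intro exI conjI allI impI, rule D, elim conjE)
    fix \<omega> l assume p: "(\<omega>, l) \<in> topspace fibre_product" and C: "Om.right_orbits.orbit \<omega> \<in> C"
    then have \<omega>: "\<omega> \<in> topspace (ctop \<Omega>)" and l: "l \<in> topspace (ctop \<Lambda>)"
      and eq: "ranchor \<Omega> \<omega> = lanchor \<Lambda> l" unfolding mem_fibre_product by auto
    obtain n h where n: "n \<in> N" and h: "h \<in> arrows H" "ranchor \<Omega> n = grng H h" "\<omega> = ract \<Omega> n h"
      using repN[rule_format, OF \<omega> C] by blast
    have nX: "n \<in> topspace (ctop \<Omega>)" using n compactin_subset_topspace[OF N] by blast
    have src: "gsrc H h = lanchor \<Lambda> l"
      using eq h Om.right_orbits.anchor_act[OF nX h(1,2)] by simp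
    \<comment> \<open>The representative \<open>(n, l')\<close> of the class \<open>[\<omega>, l]\<close> has its first component in \<open>N\<close>.\<close>
    define l' where "l' = lact \<Lambda> h l"
    have l': "l' \<in> topspace (ctop \<Lambda>)" "lanchor \<Lambda> l' = ranchor \<Omega> n"
      using l h src unfolding l'_def by (simp_all add: La.lact_closed La.left.anchor_act)
    have p': "(n, l') \<in> topspace fibre_product" using nX l' by simp
    have "(\<omega>, l) = (ract \<Omega> n h, lact \<Lambda> (ginv H h) l')"
      unfolding l'_def using h(3) La.lact_inv[OF l h(1) src] by simp
    then have 1: "diagonal.orbit (\<omega>, l) = diagonal.orbit (n, l')"
      using diagonal.orbit_act[OF p' h(1)] h(2) by simp
    have "La.right_orbits.orbit l' \<in> ?P" using n l' by blast
    from repM[rule_format, OF l'(1) this]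
    obtain m k where m: "m \<in> M" and k: "k \<in> arrows K" "ranchor \<Lambda> m = grng K k" "l' = ract \<Lambda> m k"
      by blast
    have mX: "m \<in> topspace (ctop \<Lambda>)" using m compactin_subset_topspace[OF M] by blast
    have nm: "(n, m) \<in> topspace fibre_product"
      using nX mX l'(2) k La.lanchor_ract[OF mX k(1,2)] by simp
    have "composite_orbits.orbit (diagonal.orbit (n, l')) = composite_orbits.orbit (diagonal.orbit (n, m))"
      using composite_orbits.orbit_act[of "diagonal.orbit (n, m)" k] nm k
      by (simp add: topspace_composite ract_composite ranchor_composite del: topspace_subtopology topspace_prod_topology)
    moreover have "(n, m) \<in> ?E \<inter> (N \<times> M)" using nm n m by simp
    ultimately show "composite_orbits.orbit (diagonal.orbit (\<omega>, l)) \<in> ?q ` (?E \<inter> (N \<times> M))"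
      unfolding 1 by (metis (no_types, lifting) comp_apply imageI)
  qed
qed

section \<open>The isomorphism between iterated and composed induction\<close>

text \<open>A continuous map into the bundle takes values in tubes, and the elements of a fibre are restrictions
of sections by definition.\<close>

lemma Ind_Ind_fibre:
  assumes \<xi>: "\<xi> \<in> Ind_sections H \<Omega> Ind_\<Lambda>" and \<omega>: "\<omega> \<in> topspace (ctop \<Omega>)"
  obtains a where "a \<in> Ind_sections K \<Lambda> (C0_algebra K)"
    "\<xi> \<omega> = restrict a (anchor_fibre \<Lambda> (ranchor \<Omega> \<omega>))"
proof -
  have "continuous_map (ctop \<Omega>) (bundle_topology H Ind_\<Lambda>) (\<lambda>\<omega>. (ranchor \<Omega> \<omega>, \<xi> \<omega>))"
    using \<xi> by (simp add: Ind_sections_def)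
  then have "\<exists>a U \<epsilon>. (ranchor \<Omega> \<omega>, \<xi> \<omega>) \<in> bundle_tube Ind_\<Lambda> a U \<epsilon>"
    using \<omega> unfolding continuous_map_bundle_iff by blast
  then have "\<xi> \<omega> \<in> (\<lambda>a. restrict a (anchor_fibre \<Lambda> (ranchor \<Omega> \<omega>))) ` Ind_sections K \<Lambda> (C0_algebra K)"
    unfolding bundle_tube_Ind_C0 by blast
  then show thesis using that by blast
qed

text \<open>The supremum that defines the norm is an upper bound because \<open>\<xi> \<omega>\<close>, as the restriction of an element
of the algebra induced along \<open>\<Lambda>\<close>, is bounded.\<close>

lemma Ind_Ind_value_le_norm:
  assumes \<xi>: "\<xi> \<in> Ind_sections H \<Omega> Ind_\<Lambda>" and p: "(\<omega>, l) \<in> topspace fibre_product"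
  shows "cmod (\<xi> \<omega> l) \<le> sup_cmod (anchor_fibre \<Lambda> (ranchor \<Omega> \<omega>)) (\<xi> \<omega>)"
proof -
  have \<omega>: "\<omega> \<in> topspace (ctop \<Omega>)" and l: "l \<in> anchor_fibre \<Lambda> (ranchor \<Omega> \<omega>)"
    using p by (simp_all add: anchor_fibre_def)
  obtain a where a: "a \<in> Ind_sections K \<Lambda> (C0_algebra K)"
    "\<xi> \<omega> = restrict a (anchor_fibre \<Lambda> (ranchor \<Omega> \<omega>))"
    using Ind_Ind_fibre[OF \<xi> \<omega>] .
  obtain B where "\<forall>l \<in> topspace (ctop \<Lambda>). cmod (a l) \<le> B"
    using a(1)[unfolded La.Ind_sections_C0] by blast
  then have "cmod (\<xi> \<omega> l) \<le> B" if "l \<in> anchor_fibre \<Lambda> (ranchor \<Omega> \<omega>)" for l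
    using that a(2) by (simp add: anchor_fibre_def)
  then show ?thesis using l by (rule sup_cmod_upper)
qed

text \<open>By equivariance \<open>\<xi> (\<omega> h)\<close> is \<open>\<xi> \<omega>\<close> precomposed with the action of \<open>h\<close>, which undoes that of \<open>h\<^sup>-\<^sup>1\<close> on \<open>l\<close>.\<close>

lemma Ind_Ind_diagonal_invariant:
  assumes \<xi>: "\<xi> \<in> Ind_sections H \<Omega> Ind_\<Lambda>" and p: "(\<omega>, l) \<in> topspace fibre_product"
    and h: "h \<in> arrows H" "grng H h = ranchor \<Omega> \<omega>"
  shows "\<xi> (ract \<Omega> \<omega> h) (lact \<Lambda> (ginv H h) l) = \<xi> \<omega> l"
proof -
  have \<omega>: "\<omega> \<in> topspace (ctop \<Omega>)" and l: "l \<in> topspace (ctop \<Lambda>)" "grng H h = lanchor \<Lambda> l"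
    using p h by simp_all
  have "\<xi> (ract \<Omega> \<omega> h) = fibre_act Ind_\<Lambda> (ginv H h) (\<xi> \<omega>)"
    using \<xi> \<omega> h unfolding Ind_sections_def by blast
  moreover have "lact \<Lambda> (ginv H h) l \<in> anchor_fibre \<Lambda> (grng H (ginv H h))"
    using l h by (simp add: anchor_fibre_def La.lact_closed La.left.anchor_act Om.H.inv_closed Om.H.src_inv)
  ultimately show ?thesis
    using La.lact_inv[OF l(1), of "ginv H h"] h l
    by (simp add: Ind_C0_simps Om.H.inv_closed Om.H.src_inv)
qed

text \<open>Let \<open>a\<close> represent the value of \<open>\<xi>\<close> at \<open>\<omega>0\<close>. For \<open>\<omega>\<close> near \<open>\<omega>0\<close>, the section \<open>\<xi>\<close> stays in a thin tube
around \<open>a\<close>, so \<open>\<xi> \<omega> l\<close> is close to \<open>a l\<close> uniformly in \<open>l\<close>; and \<open>a l\<close> is close to \<open>a l0\<close>.\<close>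

lemma continuous_map_Ind_Ind_eval:
  assumes \<xi>: "\<xi> \<in> Ind_sections H \<Omega> Ind_\<Lambda>"
  shows "continuous_map fibre_product euclidean (\<lambda>(\<omega>, l). \<xi> \<omega> l)"
  unfolding continuous_map_complex_iff
proof (intro ballI allI impI, unfold split_paired_all prod.case)
  fix \<omega>0 l0 and \<epsilon> :: real assume p0: "(\<omega>0, l0) \<in> topspace fibre_product" and \<epsilon>: "\<epsilon> > 0"
  have \<omega>0: "\<omega>0 \<in> topspace (ctop \<Omega>)" and l0: "l0 \<in> topspace (ctop \<Lambda>)" "ranchor \<Omega> \<omega>0 = lanchor \<Lambda> l0"
    using p0 by simp_all
  obtain a where a: "a \<in> Ind_sections K \<Lambda> (C0_algebra K)"
    "\<xi> \<omega>0 = restrict a (anchor_fibre \<Lambda> (ranchor \<Omega> \<omega>0))"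
    using Ind_Ind_fibre[OF \<xi> \<omega>0] .
  have cont: "continuous_map (ctop \<Omega>) (bundle_topology H Ind_\<Lambda>) (\<lambda>\<omega>. (ranchor \<Omega> \<omega>, \<xi> \<omega>))"
    using \<xi> by (simp add: Ind_sections_def)
  have a_mem: "a \<in> alg_set (alg_of Ind_\<Lambda>)" using a(1) by (simp add: alg_set_Ind)
  note \<epsilon>2 = half_gt_zero[OF \<epsilon>]
  let ?V = "{\<omega> \<in> topspace (ctop \<Omega>). (ranchor \<Omega> \<omega>, \<xi> \<omega>) \<in> bundle_tube Ind_\<Lambda> a (topspace (unit_space H)) (\<epsilon>/2)}"
  have V: "openin (ctop \<Omega>) ?V"
    by (rule openin_bundle_tube_preimage[OF cont a_mem openin_topspace \<epsilon>2])
  have "sup_cmod (anchor_fibre \<Lambda> (ranchor \<Omega> \<omega>0)) (\<lambda>l. \<xi> \<omega>0 l - a l) \<le> 0"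
    by (rule sup_cmod_least) (simp_all add: a(2))
  moreover have "ranchor \<Omega> \<omega>0 \<in> topspace (unit_space H)"
    unfolding Om.H.topspace_unit_space using \<omega>0 by (rule Om.right_orbits.anchor_unit)
  ultimately have \<omega>0V: "\<omega>0 \<in> ?V"
    using \<omega>0 a \<epsilon> by (simp add: bundle_tube_Ind_C0 del: topspace_subtopology)
  have "continuous_map (ctop \<Lambda>) euclidean a" using a(1)[unfolded La.Ind_sections_C0] by blast
  from this[unfolded continuous_map_complex_iff, rule_format, OF l0(1) \<epsilon>2]
  obtain W where W: "openin (ctop \<Lambda>) W" "l0 \<in> W" "\<And>l. l \<in> W \<Longrightarrow> cmod (a l - a l0) < \<epsilon>/2"
    by auto
  obtain B where B: "\<forall>l \<in> topspace (ctop \<Lambda>). cmod (a l) \<le> B"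
    using a(1)[unfolded La.Ind_sections_C0] by blast
  have "openin (prod_topology (ctop \<Omega>) (ctop \<Lambda>)) (?V \<times> W)"
    using V W(1) by (simp add: openin_prod_Times_iff)
  then have open_U: "openin fibre_product (topspace fibre_product \<inter> (?V \<times> W))"
    by (auto simp: openin_subtopology)
  have mem_U: "(\<omega>0, l0) \<in> topspace fibre_product \<inter> (?V \<times> W)"
    using p0 \<omega>0V W(2) by blast
  have small: "cmod (\<xi> \<omega> l - \<xi> \<omega>0 l0) < \<epsilon>" if p: "(\<omega>, l) \<in> topspace fibre_product \<inter> (?V \<times> W)" for \<omega> l
  proof -
    have \<omega>: "\<omega> \<in> topspace (ctop \<Omega>)" and l: "l \<in> anchor_fibre \<Lambda> (ranchor \<Omega> \<omega>)" and "l \<in> W"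
      using p by (simp_all add: anchor_fibre_def)
    have p': "(\<omega>, l') \<in> topspace fibre_product" if "l' \<in> anchor_fibre \<Lambda> (ranchor \<Omega> \<omega>)" for l'
      using that \<omega> by (simp add: anchor_fibre_def)
    have "cmod (\<xi> \<omega> l' - a l') \<le> sup_cmod (anchor_fibre \<Lambda> (ranchor \<Omega> \<omega>)) (\<xi> \<omega>) + B"
      if "l' \<in> anchor_fibre \<Lambda> (ranchor \<Omega> \<omega>)" for l'
      using Ind_Ind_value_le_norm[OF \<xi> p'[OF that]] B that norm_triangle_ineq4[of "\<xi> \<omega> l'" "a l'"]
      by (force simp: anchor_fibre_def)
    then have "cmod (\<xi> \<omega> l - a l) \<le> sup_cmod (anchor_fibre \<Lambda> (ranchor \<Omega> \<omega>)) (\<lambda>l. \<xi> \<omega> l - a l)"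
      using l by (rule sup_cmod_upper)
    also have "\<dots> < \<epsilon>/2"
    proof -
      have "(ranchor \<Omega> \<omega>, \<xi> \<omega>) \<in> bundle_tube Ind_\<Lambda> a (topspace (unit_space H)) (\<epsilon>/2)" using p by blast
      then show ?thesis unfolding bundle_tube_Ind_C0 by blast
    qed
    finally have "cmod (\<xi> \<omega> l - a l) < \<epsilon>/2" .
    moreover have "\<xi> \<omega>0 l0 = a l0" using a(2) l0 by (simp add: anchor_fibre_def)
    ultimately show ?thesis
      using W(3)[OF \<open>l \<in> W\<close>] norm_diff_triangle_less by fastforce
  qed
  show "\<exists>U. openin fibre_product U \<and> (\<omega>0, l0) \<in> U \<and>
      (\<forall>p\<in>U. cmod ((case p of (\<omega>, l) \<Rightarrow> \<xi> \<omega> l) - \<xi> \<omega>0 l0) < \<epsilon>)"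
  proof (intro exI conjI ballI, rule open_U, rule mem_U)
    fix p assume "p \<in> topspace fibre_product \<inter> (?V \<times> W)"
    then show "cmod ((case p of (\<omega>, l) \<Rightarrow> \<xi> \<omega> l) - \<xi> \<omega>0 l0) < \<epsilon>"
      by (cases p) (simp only: prod.case small)
  qed
qed

lemma Ind_comp_iso_apply:
  assumes "\<xi> \<in> Ind_sections H \<Omega> Ind_\<Lambda>" and "(\<omega>, l) \<in> topspace fibre_product"
  shows "Ind_comp_iso G H K \<Omega> \<Lambda> (C0_algebra K) \<xi> (diagonal.orbit (\<omega>, l)) = \<xi> \<omega> l"
  using assms lift_class_composite[OF assms(2), of \<xi>] Ind_Ind_diagonal_invariant[OF assms]
  unfolding Ind_comp_iso_def alg_set_Ind topspace_composite by (simp del: topspace_subtopology)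

text \<open>Invariance under \<open>K\<close> holds since each \<open>\<xi> \<omega>\<close> is the restriction of a \<open>K\<close>-invariant function. The value at
\<open>[\<omega>, l]\<close> is bounded by the norm of \<open>\<xi> \<omega>\<close>, which is small for \<open>[\<omega>]\<close> outside a compact subset of \<open>\<Omega>/H\<close>, and
the part of the composition that lies over this subset is contained in a compact set modulo \<open>K\<close>.\<close>

lemma Ind_comp_iso_in_Ind:
  assumes proper: "proper_correspondence H K \<Lambda>" and \<xi>: "\<xi> \<in> Ind_sections H \<Omega> Ind_\<Lambda>"
  shows "Ind_comp_iso G H K \<Omega> \<Lambda> (C0_algebra K) \<xi> \<in> Ind_sections K composite (C0_algebra K)"
  (is "?\<zeta> \<in> _")
proof -
  have equi: "\<xi> (ract \<Omega> \<omega> h) = fibre_act Ind_\<Lambda> (ginv H h) (\<xi> \<omega>)"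
    if "\<omega> \<in> topspace (ctop \<Omega>)" "h \<in> arrows H" "grng H h = ranchor \<Omega> \<omega>" for \<omega> h
    using \<xi> that unfolding Ind_sections_def by blast
  have inv: "?\<zeta> (ract composite z k) = ?\<zeta> z"
    if z: "z \<in> topspace (ctop composite)" and k: "k \<in> arrows K" "grng K k = ranchor composite z" for z k
  proof -
    obtain \<omega> l where p: "(\<omega>, l) \<in> topspace fibre_product" and zp: "z = diagonal.orbit (\<omega>, l)"
      using z by (rule topspace_compositeE)
    have k': "ranchor \<Lambda> l = grng K k" using k(2) p unfolding zp by (simp only: ranchor_composite)
    have \<omega>: "\<omega> \<in> topspace (ctop \<Omega>)" and l: "l \<in> topspace (ctop \<Lambda>)" "ranchor \<Omega> \<omega> = lanchor \<Lambda> l"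
      using p by simp_all
    obtain a where a: "a \<in> Ind_sections K \<Lambda> (C0_algebra K)"
      "\<xi> \<omega> = restrict a (anchor_fibre \<Lambda> (ranchor \<Omega> \<omega>))"
      using Ind_Ind_fibre[OF \<xi> \<omega>] .
    have "a (ract \<Lambda> l k) = a l"
      using a(1)[unfolded La.Ind_sections_C0] l(1) k(1) k' by simp
    then have "\<xi> \<omega> (ract \<Lambda> l k) = \<xi> \<omega> l"
      using a(2) l k(1) k' by (simp add: anchor_fibre_def La.lanchor_ract La.right_orbits.act_closed)
    then show ?thesis
      unfolding zp ract_composite[OF p k(1) k'] Ind_comp_iso_apply[OF \<xi> p]
        Ind_comp_iso_apply[OF \<xi> ract_fibre_product[OF p k(1) k']] .
  qed
  show ?thesis
    unfolding Ind_sections_C0_iff[OF La.H.etale_groupoid_axioms continuous_ranchor_composite]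
  proof (intro conjI ballI impI)
    show "?\<zeta> \<in> extensional (topspace (ctop composite))"
      using \<xi> by (simp add: Ind_comp_iso_def alg_set_Ind)
    show "continuous_map (ctop composite) euclidean ?\<zeta>"
    proof (rule continuous_compose_quotient_map[OF quotient_map_composite])
      show "continuous_map fibre_product euclidean (?\<zeta> \<circ> diagonal.orbit)"
        using continuous_map_Ind_Ind_eval[OF \<xi>]
        by (rule continuous_map_eq) (use Ind_comp_iso_apply[OF \<xi>] in force)
    qed
    obtain B where B: "\<forall>\<omega>\<in>topspace (ctop \<Omega>). sup_cmod (anchor_fibre \<Lambda> (ranchor \<Omega> \<omega>)) (\<xi> \<omega>) \<le> B"
      using \<xi> unfolding Ind_sections_def Ind_C0_simps by blast
    show "\<exists>B. \<forall>z\<in>topspace (ctop composite). cmod (?\<zeta> z) \<le> B"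
    proof (intro exI ballI)
      fix z assume "z \<in> topspace (ctop composite)"
      then obtain \<omega> l where p: "(\<omega>, l) \<in> topspace fibre_product" and zp: "z = diagonal.orbit (\<omega>, l)"
        by (rule topspace_compositeE)
      have "\<omega> \<in> topspace (ctop \<Omega>)" using p by simp
      then have "cmod (\<xi> \<omega> l) \<le> B" using Ind_Ind_value_le_norm[OF \<xi> p] B by force
      then show "cmod (?\<zeta> z) \<le> B" unfolding zp Ind_comp_iso_apply[OF \<xi> p] .
    qed
    show "vanishes_at_infinity (corr_quotient K composite) (lift_class (\<lambda>z. cmod (?\<zeta> z)))"
    proof (rule vanishes_at_infinity_corr_quotientI)
      fix \<epsilon> :: real assume \<epsilon>: "\<epsilon> > 0"
      let ?n = "lift_class (\<lambda>\<omega>. alg_norm (fibre Ind_\<Lambda> (ranchor \<Omega> \<omega>)) (\<xi> \<omega>))"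
      have "vanishes_at_infinity (corr_quotient H \<Omega>) ?n"
        using \<xi> unfolding Ind_sections_def by blast
      then obtain C where C: "compactin (corr_quotient H \<Omega>) C"
        and small: "\<forall>z\<in>topspace (corr_quotient H \<Omega>) - C. \<bar>?n z\<bar> < \<epsilon>"
        using \<epsilon> unfolding vanishes_at_infinity_def by blast
      obtain D where D: "compactin (corr_quotient K composite) D"
        and CD: "\<forall>\<omega> l. (\<omega>, l) \<in> topspace fibre_product \<and> Om.right_orbits.orbit \<omega> \<in> C \<longrightarrow>
          composite_orbits.orbit (diagonal.orbit (\<omega>, l)) \<in> D"
        using compactin_composite_quotient_over[OF proper C] by blast
      have "\<bar>lift_class (\<lambda>z. cmod (?\<zeta> z)) (composite_orbits.orbit z)\<bar> < \<epsilon>"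
        if z: "z \<in> topspace (ctop composite)" "composite_orbits.orbit z \<notin> D" for z
      proof -
        obtain \<omega> l where p: "(\<omega>, l) \<in> topspace fibre_product" and zp: "z = diagonal.orbit (\<omega>, l)"
          using z(1) by (rule topspace_compositeE)
        have \<omega>: "\<omega> \<in> topspace (ctop \<Omega>)" using p by simp
        have "Om.right_orbits.orbit \<omega> \<notin> C" using CD p z(2) unfolding zp by blast
        then have "\<bar>?n (Om.right_orbits.orbit \<omega>)\<bar> < \<epsilon>"
          using \<omega> by (intro bspec[OF small]) (simp add: Om.topspace_corr_quotient)
        moreover have "?n (Om.right_orbits.orbit \<omega>) = sup_cmod (anchor_fibre \<Lambda> (ranchor \<Omega> \<omega>)) (\<xi> \<omega>)"
          by (rule lift_class_fibre_norm[OF equi \<omega>])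
        ultimately have "cmod (\<xi> \<omega> l) < \<epsilon>" using Ind_Ind_value_le_norm[OF \<xi> p] by linarith
        moreover have "lift_class (\<lambda>z. cmod (?\<zeta> z)) (composite_orbits.orbit z) = cmod (?\<zeta> z)"
          using z(1) by (rule composite_orbits.lift_class_orbit) (simp add: inv[OF z(1)])
        ultimately show ?thesis unfolding zp Ind_comp_iso_apply[OF \<xi> p] by simp
      qed
      then show "\<exists>D. compactin (corr_quotient K composite) D \<and>
          (\<forall>z\<in>topspace (ctop composite). corr_class K composite z \<notin> D \<longrightarrow>
            \<bar>lift_class (\<lambda>z. cmod (?\<zeta> z)) (corr_class K composite z)\<bar> < \<epsilon>)"
        unfolding corr_class_def by (intro exI[of _ D] conjI ballI impI D)
    qed
  qed (rule inv)
qed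

lemma Ind_comp_iso_fibrewise_constant_pullback:
  assumes "proper_correspondence G H \<Omega>" "proper_correspondence H K \<Lambda>"
    and f: "f \<in> C0_functions (unit_space G)"
  shows "Ind_comp_iso G H K \<Omega> \<Lambda> (C0_algebra K) (fibrewise_constant (anchor_pullback G \<Omega> f))
    = anchor_pullback G composite f"
proof
  fix z
  have mem: "fibrewise_constant (anchor_pullback G \<Omega> f) \<in> Ind_sections H \<Omega> Ind_\<Lambda>"
    by (rule fibrewise_constant_in_Ind[OF assms(2) Om.anchor_pullback_in_Ind[OF assms(1) f]])
  show "Ind_comp_iso G H K \<Omega> \<Lambda> (C0_algebra K) (fibrewise_constant (anchor_pullback G \<Omega> f)) z
    = anchor_pullback G composite f z"
  proof (cases "z \<in> topspace (ctop composite)")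
    case True
    then obtain \<omega> l where p: "(\<omega>, l) \<in> topspace fibre_product" and zp: "z = diagonal.orbit (\<omega>, l)"
      by (rule topspace_compositeE)
    have "fibrewise_constant (anchor_pullback G \<Omega> f) \<omega> l = f (lanchor \<Omega> \<omega>)"
      using p f by (simp add: fibrewise_constant_def anchor_fibre_def Om.anchor_pullback_apply)
    moreover have "anchor_pullback G composite f z = f (lanchor composite z)"
      using f True by (simp add: anchor_pullback_def)
    ultimately show ?thesis unfolding zp Ind_comp_iso_apply[OF mem p] lanchor_composite[OF p] by simp
  next
    case False
    then show ?thesis using mem f by (simp add: Ind_comp_iso_def anchor_pullback_def alg_set_Ind)
  qed
qed

end

theorem proposition7p8:
  fixes G :: "'g groupoid" and H :: "'h groupoid" and K :: "'k groupoid"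
    and \<Omega> :: "('o, 'g, 'h) correspondence" and \<Lambda> :: "('l, 'h, 'k) correspondence"
  assumes "etale_correspondence G H \<Omega>" and "etale_correspondence H K \<Lambda>"
    and "Hausdorff_correspondence G H \<Omega>" and "Hausdorff_correspondence H K \<Lambda>"
    and "second_countable_correspondence G H \<Omega>" and "second_countable_correspondence H K \<Lambda>"
    and "proper_correspondence G H \<Omega>" and "proper_correspondence H K \<Lambda>"
  shows
    "let C0G = C0_algebra G; C0H = C0_algebra H; C0K = C0_algebra K;
         \<phi> = Ind_comp_iso G H K \<Omega> \<Lambda> C0K;
         Ind_\<rho>\<Lambda> = Ind_map G H \<Omega> C0H (Ind H K \<Lambda> C0K) (anchor_pullback H \<Lambda>);
         \<rho>\<Omega> = anchor_pullback G \<Omega>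
     in \<rho>\<Omega> \<in> alg_set (alg_of C0G) \<rightarrow> alg_set (alg_of (Ind G H \<Omega> C0H)) \<and>
        Ind_\<rho>\<Lambda> \<in> alg_set (alg_of (Ind G H \<Omega> C0H))
          \<rightarrow> alg_set (alg_of (Ind G H \<Omega> (Ind H K \<Lambda> C0K))) \<and>
        \<phi> \<in> alg_set (alg_of (Ind G H \<Omega> (Ind H K \<Lambda> C0K)))
          \<rightarrow> alg_set (alg_of (Ind G K (corr_comp H \<Lambda> \<Omega>) C0K)) \<and>
        compose (alg_set (alg_of C0G)) \<phi> (compose (alg_set (alg_of C0G)) Ind_\<rho>\<Lambda> \<rho>\<Omega>)
          = anchor_pullback G (corr_comp H \<Lambda> \<Omega>)"
proof -
  interpret composable_correspondences G H K \<Omega> \<Lambda>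
    by (simp add: composable_correspondences_def assms)
  note proper = assms(7,8)
  show ?thesis
    unfolding Let_def C0_algebra_simps alg_set_Ind
  proof (intro conjI funcsetI)
    fix f assume "f \<in> C0_functions (unit_space G)"
    then show "anchor_pullback G \<Omega> f \<in> Ind_sections H \<Omega> (C0_algebra H)"
      by (rule Om.anchor_pullback_in_Ind[OF proper(1)])
  next
    fix \<xi> assume \<xi>: "\<xi> \<in> Ind_sections H \<Omega> (C0_algebra H)"
    then show "Ind_map G H \<Omega> (C0_algebra H) Ind_\<Lambda> (anchor_pullback H \<Lambda>) \<xi> \<in> Ind_sections H \<Omega> Ind_\<Lambda>"
      unfolding Ind_map_anchor_pullback[OF \<xi>] by (rule fibrewise_constant_in_Ind[OF proper(2)])
  next
    fix \<xi> assume "\<xi> \<in> Ind_sections H \<Omega> Ind_\<Lambda>"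
    then show "Ind_comp_iso G H K \<Omega> \<Lambda> (C0_algebra K) \<xi> \<in> Ind_sections K composite (C0_algebra K)"
      by (rule Ind_comp_iso_in_Ind[OF proper(2)])
  next
    show "compose (C0_functions (unit_space G)) (Ind_comp_iso G H K \<Omega> \<Lambda> (C0_algebra K))
        (compose (C0_functions (unit_space G))
          (Ind_map G H \<Omega> (C0_algebra H) Ind_\<Lambda> (anchor_pullback H \<Lambda>)) (anchor_pullback G \<Omega>))
      = anchor_pullback G composite"
    proof
      fix f
      show "compose (C0_functions (unit_space G)) (Ind_comp_iso G H K \<Omega> \<Lambda> (C0_algebra K))
          (compose (C0_functions (unit_space G))
            (Ind_map G H \<Omega> (C0_algebra H) Ind_\<Lambda> (anchor_pullback H \<Lambda>)) (anchor_pullback G \<Omega>)) f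
        = anchor_pullback G composite f"
      proof (cases "f \<in> C0_functions (unit_space G)")
        case True
        then show ?thesis
          using Ind_comp_iso_fibrewise_constant_pullback[OF proper True]
            Ind_map_anchor_pullback[OF Om.anchor_pullback_in_Ind[OF proper(1) True]]
          by (simp add: compose_def)
      next
        case False
        then show ?thesis by (simp add: compose_def anchor_pullback_def)
      qed
    qed
  qed
qed

end
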